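(* Let $\mathbb{B}$ be a bicategory and let $\eta_f,\varepsilon_f : f\dashv f^* : \mathcal{B}\to\mathcal{A}$ be an adjunction in $\mathbb{B}$ (so $f:\mathcal{A}\to\mathcal{B}$, $f^*:\mathcal{B}\to\mathcal{A}$) such that the functor $\mathbb{B}(\mathcal{A},f)=f\otimes - :\mathbb{B}(\mathcal{A},\mathcal{A})\to\mathbb{B}(\mathcal{A},\mathcal{B})$ is comonadic. Then the rule $[(h,i_h)]\mapsto\theta_h$, where $\theta_h: f\otimes f^*\to f\otimes f^*$ is the composite $$(f\otimes r_{f^*})\cdot(f\otimes(f^*\otimes\varepsilon_f))\cdot(f\otimes\alpha_{f^*,f,f^*})\cdot\alpha_{f,f^*\otimes f,f^*}\cdot((f\otimes i_h)\otimes f^* )\cdot((\xi_{i_h})^{-1}\otimes f^* ),$$ defines an isomorphism of monoids $$\Gamma_f:\mathbf{I}^l_{\mathbb{B}(\mathcal{A},\mathcal{A})}(S_f)\to \mathrm{End}_{\mathcal{B}}(\mathfrak{C}_f,\mathfrak{C}_f).$$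
   Context: Bicategory conventions: 1-cells $\mathcal{A}\to\mathcal{B}$ are the objects of the hom-category $\mathbb{B}(\mathcal{A},\mathcal{B})$; the horizontal composite of $f:\mathcal{A}\to\mathcal{B}$ and $g:\mathcal{B}\to\mathcal{C}$ is written $g\otimes f$; the constraints are $\alpha_{h,g,f}:(h\otimes g)\otimes f\to h\otimes(g\otimes f)$, $l_f:1_{\mathcal{B}}\otimes f\to f$, $r_f:f\otimes 1_{\mathcal{A}}\to f$; vertical composition is written $\cdot$; a 1-cell also denotes its identity 2-cell. $\mathbb{B}(\mathcal{A},\mathcal{A})$ is a monoidal category under $\otimes$. An adjunction $\eta_f,\varepsilon_f:f\dashv f^*$ consists of 2-cells $\eta_f:1_{\mathcal{A}}\to f^*\otimes f$, $\varepsilon_f:f\otimes f^*\to 1_{\mathcal{B}}$ satisfying the triangle identities. $S_f$ is the monoid $(f^*\otimes f,m_f,\eta_f)$ in $\mathbb{B}(\mathcal{A},\mathcal{A})$, with $m_f:(f^*\otimes f)\otimes(f^*\otimes f)\to f^*\otimes f$ given (up to the constraint isomorphisms) by $f^*\otimes\varepsilon_f\otimes f$. $\mathfrak{C}_f$ is the comonoid $(f\otimes f^*,\delta_f,\varepsilon_f)$ in $\mathbb{B}(\mathcal{B},\mathcal{B})$, with $\delta_f$ given (up to constraints) by $f\otimes\eta_f\otimes f^*$. $\mathrm{End}_{\mathcal{B}}(\mathfrak{C}_f,\mathfrak{C}_f)$ is the monoid, under composition, of endomorphisms of the comonoid $\mathfrak{C}_f$. For a monoid $\mathbb{S}=(S,e_S,m_S)$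 in a monoidal category $\mathcal{V}$, $\mathbf{I}^l_{\mathcal{V}}(\mathbb{S})$ is the class of subobjects $[(J,i_J:J\to S)]$ of $S$ (equivalence classes of monomorphisms into $S$) such that $m_S\cdot(S\otimes i_J):S\otimes J\to S$ is an isomorphism. When $e_S\otimes X$ is a monomorphism for all $X$ (which holds for $S_f$ under the hypothesis of the theorem), it is a monoid with product $[(J_1,i_{J_1})]\cdot[(J_2,i_{J_2})]=[(J_1\otimes J_2,\,m_S\cdot(i_{J_1}\otimes i_{J_2}))]$ and unit $[(I,e_S)]$. For $[(h,i_h:h\to f^*\otimes f)]\in \mathbf{I}^l_{\mathbb{B}(\mathcal{A},\mathcal{A})}(S_f)$, $\xi_{i_h}:f\otimes h\to f$ is the 2-cell $l_f\cdot(\varepsilon_f\otimes f)\cdot(\alpha_{f,f^*,f})^{-1}\cdot(f\otimes i_h)$, which is invertible. A functor $F$ with right adjoint $U$, unit $\eta$ and counit $\varepsilon$ is comonadic if the comparison functor $a\mapsto(F(a),F(\eta_a))$ to the category of coalgebras over the comonad $(FU,\varepsilon,F\eta U)$ is an equivalence. Here $f\otimes -$ has right adjoint $f^*\otimes -:\mathbb{B}(\mathcal{A},\mathcal{B})\to\mathbb{B}(\mathcal{A},\mathcal{A})$. *)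

theory Defs
  imports "HOL-Algebra.Group"
begin

section \<open>Categories, functors, comonadicity\<close>

record ('o, 'm) cat =
  Ob :: "'o set"
  Ar :: "'m set"
  Dom :: "'m \<Rightarrow> 'o"
  Cod :: "'m \<Rightarrow> 'o"
  Id :: "'o \<Rightarrow> 'm"
  Cmp :: "'m \<Rightarrow> 'm \<Rightarrow> 'm"  \<comment> \<open>\<open>Cmp C l k\<close> is ``\<open>l\<close> after \<open>k\<close>''\<close>

definition Hom :: "('o, 'm) cat \<Rightarrow> 'o \<Rightarrow> 'o \<Rightarrow> 'm set" where
  "Hom C x y = {k \<in> Ar C. Dom C k = x \<and> Cod C k = y}"

locale category =
  fixes C :: "('o, 'm) cat"
  assumes Dom_Ob: "k \<in> Ar C \<Longrightarrow> Dom C k \<in> Ob C"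
    and Cod_Ob: "k \<in> Ar C \<Longrightarrow> Cod C k \<in> Ob C"
    and Id_Hom: "x \<in> Ob C \<Longrightarrow> Id C x \<in> Hom C x x"
    and Cmp_Hom: "k \<in> Hom C x y \<Longrightarrow> l \<in> Hom C y z \<Longrightarrow> Cmp C l k \<in> Hom C x z"
    and Cmp_Id_left: "k \<in> Hom C x y \<Longrightarrow> Cmp C (Id C y) k = k"
    and Cmp_Id_right: "k \<in> Hom C x y \<Longrightarrow> Cmp C k (Id C x) = k"
    and Cmp_assoc: "k \<in> Hom C w x \<Longrightarrow> l \<in> Hom C x y \<Longrightarrow> m \<in> Hom C y z \<Longrightarrow>
           Cmp C (Cmp C m l) k = Cmp C m (Cmp C l k)"

definition inverse_arrows :: "('o, 'm) cat \<Rightarrow> 'm \<Rightarrow> 'm \<Rightarrow> bool" where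
  "inverse_arrows C k l \<longleftrightarrow> k \<in> Ar C \<and> l \<in> Hom C (Cod C k) (Dom C k) \<and>
     Cmp C l k = Id C (Dom C k) \<and> Cmp C k l = Id C (Cod C k)"

definition is_isomorphism :: "('o, 'm) cat \<Rightarrow> 'm \<Rightarrow> bool" where
  "is_isomorphism C k \<longleftrightarrow> (\<exists>l. inverse_arrows C k l)"

definition Inv :: "('o, 'm) cat \<Rightarrow> 'm \<Rightarrow> 'm" where
  "Inv C k = (THE l. inverse_arrows C k l)"

definition is_mono :: "('o, 'm) cat \<Rightarrow> 'm \<Rightarrow> bool" where
  "is_mono C i \<longleftrightarrow> i \<in> Ar C \<and>
     (\<forall>w. \<forall>k \<in> Hom C w (Dom C i). \<forall>l \<in> Hom C w (Dom C i). Cmp C i k = Cmp C i l \<longrightarrow> k = l)"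

text \<open>The class \<open>[(J, i)]\<close> of a monomorphism \<open>i : J \<rightarrow> S\<close>; the object \<open>J\<close> is recovered as
  \<open>Dom C i\<close>, so only the arrow is recorded.\<close>

definition subobject :: "('o, 'm) cat \<Rightarrow> 'm \<Rightarrow> 'm set" where
  "subobject C i = {j. is_mono C j \<and> Cod C j = Cod C i \<and>
     (\<exists>u \<in> Hom C (Dom C j) (Dom C i). is_isomorphism C u \<and> Cmp C i u = j)}"

record ('o, 'm, 'p, 'n) func =
  on_ob :: "'o \<Rightarrow> 'p"
  on_ar :: "'m \<Rightarrow> 'n"

definition is_functor :: "('o, 'm) cat \<Rightarrow> ('p, 'n) cat \<Rightarrow> ('o, 'm, 'p, 'n) func \<Rightarrow> bool" where
  "is_functor C D F \<longleftrightarrow>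
     (\<forall>x \<in> Ob C. on_ob F x \<in> Ob D) \<and>
     (\<forall>x \<in> Ob C. \<forall>y \<in> Ob C. \<forall>k \<in> Hom C x y. on_ar F k \<in> Hom D (on_ob F x) (on_ob F y)) \<and>
     (\<forall>x \<in> Ob C. on_ar F (Id C x) = Id D (on_ob F x)) \<and>
     (\<forall>x \<in> Ob C. \<forall>y \<in> Ob C. \<forall>z \<in> Ob C. \<forall>k \<in> Hom C x y. \<forall>l \<in> Hom C y z.
        on_ar F (Cmp C l k) = Cmp D (on_ar F l) (on_ar F k))"

definition id_func :: "('o, 'm, 'o, 'm) func" where
  "id_func = \<lparr>on_ob = (\<lambda>x. x), on_ar = (\<lambda>k. k)\<rparr>"

definition comp_func ::
    "('p, 'n, 'q, 'r) func \<Rightarrow> ('o, 'm, 'p, 'n) func \<Rightarrow> ('o, 'm, 'q, 'r) func" where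
  "comp_func G F = \<lparr>on_ob = on_ob G \<circ> on_ob F, on_ar = on_ar G \<circ> on_ar F\<rparr>"

definition is_nat_trans :: "('o, 'm) cat \<Rightarrow> ('p, 'n) cat \<Rightarrow>
    ('o, 'm, 'p, 'n) func \<Rightarrow> ('o, 'm, 'p, 'n) func \<Rightarrow> ('o \<Rightarrow> 'n) \<Rightarrow> bool" where
  "is_nat_trans C D F G t \<longleftrightarrow>
     (\<forall>x \<in> Ob C. t x \<in> Hom D (on_ob F x) (on_ob G x)) \<and>
     (\<forall>x \<in> Ob C. \<forall>y \<in> Ob C. \<forall>k \<in> Hom C x y.
        Cmp D (t y) (on_ar F k) = Cmp D (on_ar G k) (t x))"

definition is_nat_iso :: "('o, 'm) cat \<Rightarrow> ('p, 'n) cat \<Rightarrow>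
    ('o, 'm, 'p, 'n) func \<Rightarrow> ('o, 'm, 'p, 'n) func \<Rightarrow> ('o \<Rightarrow> 'n) \<Rightarrow> bool" where
  "is_nat_iso C D F G t \<longleftrightarrow> is_nat_trans C D F G t \<and> (\<forall>x \<in> Ob C. is_isomorphism D (t x))"

definition is_equivalence :: "('o, 'm) cat \<Rightarrow> ('p, 'n) cat \<Rightarrow> ('o, 'm, 'p, 'n) func \<Rightarrow> bool" where
  "is_equivalence C D F \<longleftrightarrow> is_functor C D F \<and>
     (\<exists>G s t. is_functor D C G \<and>
        is_nat_iso C C id_func (comp_func G F) s \<and>
        is_nat_iso D D (comp_func F G) id_func t)"

definition is_adjunction :: "('o, 'm) cat \<Rightarrow> ('p, 'n) cat \<Rightarrow>
    ('o, 'm, 'p, 'n) func \<Rightarrow> ('p, 'n, 'o, 'm) func \<Rightarrow> ('o \<Rightarrow> 'm) \<Rightarrow> ('p \<Rightarrow> 'n) \<Rightarrow> bool" where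
  "is_adjunction C D F U \<eta> \<epsilon> \<longleftrightarrow>
     is_functor C D F \<and> is_functor D C U \<and>
     is_nat_trans C C id_func (comp_func U F) \<eta> \<and>
     is_nat_trans D D (comp_func F U) id_func \<epsilon> \<and>
     (\<forall>x \<in> Ob C. Cmp D (\<epsilon> (on_ob F x)) (on_ar F (\<eta> x)) = Id D (on_ob F x)) \<and>
     (\<forall>y \<in> Ob D. Cmp C (on_ar U (\<epsilon> y)) (\<eta> (on_ob U y)) = Id C (on_ob U y))"

text \<open>Coalgebras over a comonad \<open>(T, \<epsilon>, \<delta>)\<close> on \<open>D\<close>. The underlying arrow of a coalgebra morphism
  does not determine the coalgebra structures on its domain and codomain, so these are stored
  with it.\<close>

definition is_coalgebra :: "('p, 'n) cat \<Rightarrow> ('p, 'n, 'p, 'n) func \<Rightarrow> ('p \<Rightarrow> 'n) \<Rightarrow> ('p \<Rightarrow> 'n) \<Rightarrow>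
    'p \<times> 'n \<Rightarrow> bool" where
  "is_coalgebra D T \<epsilon> \<delta> = (\<lambda>(y, s). y \<in> Ob D \<and> s \<in> Hom D y (on_ob T y) \<and>
     Cmp D (\<epsilon> y) s = Id D y \<and>
     Cmp D (\<delta> y) s = Cmp D (on_ar T s) s)"

definition coalgebra_cat :: "('p, 'n) cat \<Rightarrow> ('p, 'n, 'p, 'n) func \<Rightarrow> ('p \<Rightarrow> 'n) \<Rightarrow> ('p \<Rightarrow> 'n) \<Rightarrow>
    ('p \<times> 'n, ('p \<times> 'n) \<times> ('p \<times> 'n) \<times> 'n) cat" where
  "coalgebra_cat D T \<epsilon> \<delta> =
     \<lparr>Ob = {X. is_coalgebra D T \<epsilon> \<delta> X},
      Ar = {(X, Y, k). is_coalgebra D T \<epsilon> \<delta> X \<and> is_coalgebra D T \<epsilon> \<delta> Y \<and>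
              k \<in> Hom D (fst X) (fst Y) \<and>
              Cmp D (snd Y) k = Cmp D (on_ar T k) (snd X)},
      Dom = (\<lambda>(X, Y, k). X),
      Cod = (\<lambda>(X, Y, k). Y),
      Id = (\<lambda>X. (X, X, Id D (fst X))),
      Cmp = (\<lambda>(Y', Z, l) (X, Y, k). (X, Z, Cmp D l k))\<rparr>"

definition comparison_func :: "('o, 'm) cat \<Rightarrow> ('o, 'm, 'p, 'n) func \<Rightarrow> ('o \<Rightarrow> 'm) \<Rightarrow>
    ('o, 'm, 'p \<times> 'n, ('p \<times> 'n) \<times> ('p \<times> 'n) \<times> 'n) func" where
  "comparison_func C F \<eta> =
     \<lparr>on_ob = (\<lambda>x. (on_ob F x, on_ar F (\<eta> x))),
      on_ar = (\<lambda>k. ((on_ob F (Dom C k), on_ar F (\<eta> (Dom C k))),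
                    (on_ob F (Cod C k), on_ar F (\<eta> (Cod C k))),
                    on_ar F k))\<rparr>"

definition comonadic :: "('o, 'm) cat \<Rightarrow> ('p, 'n) cat \<Rightarrow>
    ('o, 'm, 'p, 'n) func \<Rightarrow> ('p, 'n, 'o, 'm) func \<Rightarrow> ('o \<Rightarrow> 'm) \<Rightarrow> ('p \<Rightarrow> 'n) \<Rightarrow> bool" where
  "comonadic C D F U \<eta> \<epsilon> \<longleftrightarrow> is_adjunction C D F U \<eta> \<epsilon> \<and>
     is_equivalence C
       (coalgebra_cat D (comp_func F U) \<epsilon> (\<lambda>y. on_ar F (\<eta> (on_ob U y))))
       (comparison_func C F \<eta>)"


section \<open>Bicategories\<close>

text \<open>\<open>Vert\<close> is the disjoint union of all hom-categories: its objects are the 1-cells, its arrows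
  the 2-cells, its composition the vertical one. Horizontal composition is written in applicative
  order, \<open>\<star>\<close> on 1-cells and \<open>\<diamondop>\<close> on 2-cells.\<close>

record ('o, 'a, 'c) bicat =
  Cells :: "'o set"
  Vert :: "('a, 'c) cat"
  Src :: "'a \<Rightarrow> 'o"
  Trg :: "'a \<Rightarrow> 'o"
  Unit :: "'o \<Rightarrow> 'a"
  HC1 :: "'a \<Rightarrow> 'a \<Rightarrow> 'a"  (infixl \<open>\<star>\<index>\<close> 75)
  HC2 :: "'c \<Rightarrow> 'c \<Rightarrow> 'c"  (infixl \<open>\<diamondop>\<index>\<close> 75)
  Assoc :: "'a \<Rightarrow> 'a \<Rightarrow> 'a \<Rightarrow> 'c"  (\<open>\<a>\<index>\<close>)
  Lunit :: "'a \<Rightarrow> 'c"  (\<open>\<l>\<index>\<close>)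
  Runit :: "'a \<Rightarrow> 'c"  (\<open>\<r>\<index>\<close>)

abbreviation VC :: "('o, 'a, 'c) bicat \<Rightarrow> 'c \<Rightarrow> 'c \<Rightarrow> 'c"  (infixr \<open>\<cdot>\<index>\<close> 65) where
  "VC B \<tau> \<sigma> \<equiv> Cmp (Vert B) \<tau> \<sigma>"

abbreviation id2 :: "('o, 'a, 'c) bicat \<Rightarrow> 'a \<Rightarrow> 'c"  (\<open>\<iota>\<index>\<close>) where
  "id2 B f \<equiv> Id (Vert B) f"

abbreviation inverse2 :: "('o, 'a, 'c) bicat \<Rightarrow> 'c \<Rightarrow> 'c"  (\<open>vinv\<index>\<close>) where
  "inverse2 B \<tau> \<equiv> Inv (Vert B) \<tau>"

abbreviation cells2 :: "('o, 'a, 'c) bicat \<Rightarrow> 'a \<Rightarrow> 'a \<Rightarrow> 'c set"  (\<open>Hom2\<index>\<close>) where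
  "cells2 B f g \<equiv> Hom (Vert B) f g"

definition cells1 :: "('o, 'a, 'c) bicat \<Rightarrow> 'o \<Rightarrow> 'o \<Rightarrow> 'a set"  (\<open>Hom1\<index>\<close>) where
  "cells1 B a b = {f \<in> Ob (Vert B). Src B f = a \<and> Trg B f = b}"

definition hom_cat :: "('o, 'a, 'c) bicat \<Rightarrow> 'o \<Rightarrow> 'o \<Rightarrow> ('a, 'c) cat" where
  "hom_cat B a b = (Vert B)
     \<lparr>Ob := Hom1 a b,
      Ar := {\<tau> \<in> Ar (Vert B). Dom (Vert B) \<tau> \<in> Hom1 a b \<and> Cod (Vert B) \<tau> \<in> Hom1 a b}\<rparr>"
  for B (structure)

locale bicategory =
  fixes B :: "('o, 'a, 'c) bicat" (structure)
  assumes Vert_category: "category (Vert B)"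
    and Src_Cells: "f \<in> Ob (Vert B) \<Longrightarrow> Src B f \<in> Cells B"
    and Trg_Cells: "f \<in> Ob (Vert B) \<Longrightarrow> Trg B f \<in> Cells B"
    and parallel_Src: "\<tau> \<in> Hom2 f g \<Longrightarrow> Src B f = Src B g"
    and parallel_Trg: "\<tau> \<in> Hom2 f g \<Longrightarrow> Trg B f = Trg B g"
    and Unit_Hom1: "a \<in> Cells B \<Longrightarrow> Unit B a \<in> Hom1 a a"
    and HC1_Hom1: "f \<in> Hom1 a b \<Longrightarrow> g \<in> Hom1 b c \<Longrightarrow> g \<star> f \<in> Hom1 a c"
    and HC2_Hom2: "f \<in> Hom1 a b \<Longrightarrow> g \<in> Hom1 b c \<Longrightarrow> \<sigma> \<in> Hom2 f f' \<Longrightarrow> \<tau> \<in> Hom2 g g' \<Longrightarrow>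
          \<tau> \<diamondop> \<sigma> \<in> Hom2 (g \<star> f) (g' \<star> f')"
    and HC2_id: "f \<in> Hom1 a b \<Longrightarrow> g \<in> Hom1 b c \<Longrightarrow> \<iota> g \<diamondop> \<iota> f = \<iota> (g \<star> f)"
    and interchange: "f \<in> Hom1 a b \<Longrightarrow> g \<in> Hom1 b c \<Longrightarrow>
          \<sigma> \<in> Hom2 f f' \<Longrightarrow> \<sigma>' \<in> Hom2 f' f'' \<Longrightarrow> \<tau> \<in> Hom2 g g' \<Longrightarrow> \<tau>' \<in> Hom2 g' g'' \<Longrightarrow>
          (\<tau>' \<cdot> \<tau>) \<diamondop> (\<sigma>' \<cdot> \<sigma>) = (\<tau>' \<diamondop> \<sigma>') \<cdot> (\<tau> \<diamondop> \<sigma>)"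
    and Assoc_Hom2: "f \<in> Hom1 a b \<Longrightarrow> g \<in> Hom1 b c \<Longrightarrow> h \<in> Hom1 c d \<Longrightarrow>
          \<a> h g f \<in> Hom2 ((h \<star> g) \<star> f) (h \<star> (g \<star> f))"
    and Assoc_iso: "f \<in> Hom1 a b \<Longrightarrow> g \<in> Hom1 b c \<Longrightarrow> h \<in> Hom1 c d \<Longrightarrow>
          is_isomorphism (Vert B) (\<a> h g f)"
    and Assoc_natural: "f \<in> Hom1 a b \<Longrightarrow> g \<in> Hom1 b c \<Longrightarrow> h \<in> Hom1 c d \<Longrightarrow>
          \<rho> \<in> Hom2 f f' \<Longrightarrow> \<sigma> \<in> Hom2 g g' \<Longrightarrow> \<tau> \<in> Hom2 h h' \<Longrightarrow>
          \<a> h' g' f' \<cdot> ((\<tau> \<diamondop> \<sigma>) \<diamondop> \<rho>) = (\<tau> \<diamondop> (\<sigma> \<diamondop> \<rho>)) \<cdot> \<a> h g f"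
    and Lunit_Hom2: "f \<in> Hom1 a b \<Longrightarrow> \<l> f \<in> Hom2 (Unit B b \<star> f) f"
    and Lunit_iso: "f \<in> Hom1 a b \<Longrightarrow> is_isomorphism (Vert B) (\<l> f)"
    and Lunit_natural: "f \<in> Hom1 a b \<Longrightarrow> \<sigma> \<in> Hom2 f f' \<Longrightarrow>
          \<l> f' \<cdot> (\<iota> (Unit B b) \<diamondop> \<sigma>) = \<sigma> \<cdot> \<l> f"
    and Runit_Hom2: "f \<in> Hom1 a b \<Longrightarrow> \<r> f \<in> Hom2 (f \<star> Unit B a) f"
    and Runit_iso: "f \<in> Hom1 a b \<Longrightarrow> is_isomorphism (Vert B) (\<r> f)"
    and Runit_natural: "f \<in> Hom1 a b \<Longrightarrow> \<sigma> \<in> Hom2 f f' \<Longrightarrow>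
          \<r> f' \<cdot> (\<sigma> \<diamondop> \<iota> (Unit B a)) = \<sigma> \<cdot> \<r> f"
    and triangle: "f \<in> Hom1 a b \<Longrightarrow> g \<in> Hom1 b c \<Longrightarrow>
          (\<iota> g \<diamondop> \<l> f) \<cdot> \<a> g (Unit B b) f = \<r> g \<diamondop> \<iota> f"
    and pentagon: "e \<in> Hom1 a b \<Longrightarrow> f \<in> Hom1 b c \<Longrightarrow> g \<in> Hom1 c d \<Longrightarrow> h \<in> Hom1 d d' \<Longrightarrow>
          \<a> h g (f \<star> e) \<cdot> \<a> (h \<star> g) f e =
          (\<iota> h \<diamondop> \<a> g f e) \<cdot> \<a> h (g \<star> f) e \<cdot> (\<a> h g f \<diamondop> \<iota> e)"

text \<open>\<open>adjunction_in B a b f f' \<eta> \<epsilon>\<close>: 2-cells \<open>\<eta>, \<epsilon>\<close> exhibit \<open>f : a \<rightarrow> b\<close> as left adjoint of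
  \<open>f' : b \<rightarrow> a\<close>.\<close>

definition adjunction_in :: "('o, 'a, 'c) bicat \<Rightarrow> 'o \<Rightarrow> 'o \<Rightarrow> 'a \<Rightarrow> 'a \<Rightarrow> 'c \<Rightarrow> 'c \<Rightarrow> bool" where
  "adjunction_in B a b f f' \<eta> \<epsilon> \<longleftrightarrow>
     f \<in> Hom1 a b \<and> f' \<in> Hom1 b a \<and>
     \<eta> \<in> Hom2 (Unit B a) (f' \<star> f) \<and> \<epsilon> \<in> Hom2 (f \<star> f') (Unit B b) \<and>
     \<l> f \<cdot> (\<epsilon> \<diamondop> \<iota> f) \<cdot> vinv (\<a> f f' f) \<cdot> (\<iota> f \<diamondop> \<eta>) \<cdot> vinv (\<r> f) = \<iota> f \<and>
     \<r> f' \<cdot> (\<iota> f' \<diamondop> \<epsilon>) \<cdot> \<a> f' f f' \<cdot> (\<eta> \<diamondop> \<iota> f') \<cdot> vinv (\<l> f') = \<iota> f'"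
  for B (structure)

text \<open>The functors \<open>f \<star> -\<close> and \<open>f' \<star> -\<close> on hom-categories, and the unit and counit of the adjunction
  between them induced by \<open>\<eta>\<close> and \<open>\<epsilon>\<close>.\<close>

definition post_func :: "('o, 'a, 'c) bicat \<Rightarrow> 'a \<Rightarrow> ('a, 'c, 'a, 'c) func" where
  "post_func B f = \<lparr>on_ob = (\<lambda>g. f \<star> g), on_ar = (\<lambda>\<tau>. \<iota> f \<diamondop> \<tau>)\<rparr>"
  for B (structure)

definition post_unit :: "('o, 'a, 'c) bicat \<Rightarrow> 'a \<Rightarrow> 'a \<Rightarrow> 'c \<Rightarrow> 'a \<Rightarrow> 'c" where
  "post_unit B f f' \<eta> x = \<a> f' f x \<cdot> (\<eta> \<diamondop> \<iota> x) \<cdot> vinv (\<l> x)"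
  for B (structure)

definition post_counit :: "('o, 'a, 'c) bicat \<Rightarrow> 'a \<Rightarrow> 'a \<Rightarrow> 'c \<Rightarrow> 'a \<Rightarrow> 'c" where
  "post_counit B f f' \<epsilon> y = \<l> y \<cdot> (\<epsilon> \<diamondop> \<iota> y) \<cdot> vinv (\<a> f f' y)"
  for B (structure)


section \<open>Invertible subobjects of a monoid, endomorphisms of a comonoid\<close>

text \<open>A monoid in the monoidal category of endo-1-cells of \<open>a\<close> is given as a triple \<open>(S, e, m)\<close> of
  carrier, unit and multiplication; a comonoid as a triple \<open>(K, d, e)\<close> of carrier,
  comultiplication and counit.\<close>

definition left_invertible :: "('o, 'a, 'c) bicat \<Rightarrow> 'o \<Rightarrow> 'a \<times> 'c \<times> 'c \<Rightarrow> 'c \<Rightarrow> bool" where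
  "left_invertible B a = (\<lambda>(S, e, m) i.
     is_mono (hom_cat B a a) i \<and> Cod (Vert B) i = S \<and>
     is_isomorphism (hom_cat B a a) (m \<cdot> (\<iota> S \<diamondop> i)))"
  for B (structure)

text \<open>The product of two classes is the union of the classes \<open>[m \<cdot> (i \<diamondop> j)]\<close> over all
  representatives \<open>i\<close>, \<open>j\<close>; it is a single class when the product is well defined.\<close>

definition Il :: "('o, 'a, 'c) bicat \<Rightarrow> 'o \<Rightarrow> 'a \<times> 'c \<times> 'c \<Rightarrow> 'c set monoid" where
  "Il B a = (\<lambda>(S, e, m).
     \<lparr>carrier = {subobject (hom_cat B a a) i | i. left_invertible B a (S, e, m) i},
      mult = (\<lambda>P Q. \<Union>i \<in> P. \<Union>j \<in> Q. subobject (hom_cat B a a) (m \<cdot> (i \<diamondop> j))),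
      one = subobject (hom_cat B a a) e\<rparr>)"
  for B (structure)

definition comonoid_End :: "('o, 'a, 'c) bicat \<Rightarrow> 'a \<times> 'c \<times> 'c \<Rightarrow> 'c monoid" where
  "comonoid_End B = (\<lambda>(K, d, e).
     \<lparr>carrier = {\<phi> \<in> Hom2 K K. e \<cdot> \<phi> = e \<and> d \<cdot> \<phi> = (\<phi> \<diamondop> \<phi>) \<cdot> d},
      mult = (\<lambda>\<phi> \<psi>. \<phi> \<cdot> \<psi>),
      one = \<iota> K\<rparr>)"
  for B (structure)

definition adj_mult :: "('o, 'a, 'c) bicat \<Rightarrow> 'a \<Rightarrow> 'a \<Rightarrow> 'c \<Rightarrow> 'c" where
  "adj_mult B f f' \<epsilon> =
     (\<iota> f' \<diamondop> \<l> f) \<cdot> (\<iota> f' \<diamondop> (\<epsilon> \<diamondop> \<iota> f)) \<cdot> (\<iota> f' \<diamondop> vinv (\<a> f f' f)) \<cdot> \<a> f' f (f' \<star> f)"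
  for B (structure)

definition adj_comult :: "('o, 'a, 'c) bicat \<Rightarrow> 'a \<Rightarrow> 'a \<Rightarrow> 'c \<Rightarrow> 'c" where
  "adj_comult B f f' \<eta> =
     vinv (\<a> f f' (f \<star> f')) \<cdot> (\<iota> f \<diamondop> \<a> f' f f') \<cdot> (\<iota> f \<diamondop> (\<eta> \<diamondop> \<iota> f')) \<cdot> (\<iota> f \<diamondop> vinv (\<l> f'))"
  for B (structure)

definition adj_monoid :: "('o, 'a, 'c) bicat \<Rightarrow> 'a \<Rightarrow> 'a \<Rightarrow> 'c \<Rightarrow> 'c \<Rightarrow> 'a \<times> 'c \<times> 'c" where
  "adj_monoid B f f' \<eta> \<epsilon> = (f' \<star> f, \<eta>, adj_mult B f f' \<epsilon>)"
  for B (structure)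

definition adj_comonoid :: "('o, 'a, 'c) bicat \<Rightarrow> 'a \<Rightarrow> 'a \<Rightarrow> 'c \<Rightarrow> 'c \<Rightarrow> 'a \<times> 'c \<times> 'c" where
  "adj_comonoid B f f' \<eta> \<epsilon> = (f \<star> f', adj_comult B f f' \<eta>, \<epsilon>)"
  for B (structure)

definition adj_xi :: "('o, 'a, 'c) bicat \<Rightarrow> 'a \<Rightarrow> 'a \<Rightarrow> 'c \<Rightarrow> 'c \<Rightarrow> 'c" where
  "adj_xi B f f' \<epsilon> i = \<l> f \<cdot> (\<epsilon> \<diamondop> \<iota> f) \<cdot> vinv (\<a> f f' f) \<cdot> (\<iota> f \<diamondop> i)"
  for B (structure)

definition adj_theta :: "('o, 'a, 'c) bicat \<Rightarrow> 'a \<Rightarrow> 'a \<Rightarrow> 'c \<Rightarrow> 'c \<Rightarrow> 'c" where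
  "adj_theta B f f' \<epsilon> i =
     (\<iota> f \<diamondop> \<r> f') \<cdot> (\<iota> f \<diamondop> (\<iota> f' \<diamondop> \<epsilon>)) \<cdot> (\<iota> f \<diamondop> \<a> f' f f') \<cdot> \<a> f (f' \<star> f) f' \<cdot>
     ((\<iota> f \<diamondop> i) \<diamondop> \<iota> f') \<cdot> (vinv (adj_xi B f f' \<epsilon> i) \<diamondop> \<iota> f')"
  for B (structure)

end

theory Submission
  imports Defs
begin

text \<open>
  Both monoids are descriptions of one set: the coalgebra structures on the object \<open>f\<close> of
  \<open>B(a, b)\<close> for the comonad \<open>f \<star> (f' \<star> -)\<close>, which is (up to associativity) the comonad
  \<open>K \<star> -\<close> with \<open>K = f \<star> f'\<close>.

  A 2-cell \<open>i : h \<rightarrow> f' \<star> f\<close> has the transpose \<open>\<xi> i : f \<star> h \<rightarrow> f\<close>. If \<open>\<xi> i\<close> is invertible, the cofree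
  coalgebra on \<open>h\<close> is carried along it to the coalgebra \<open>coact i = (f \<diamondop> i) \<cdot> (\<xi> i)\<inverse>\<close> on \<open>f\<close>. Since
  \<open>f \<star> -\<close> is comonadic, every coalgebra on \<open>f\<close> arises in this way
  (\<open>coalgebra_is_coaction\<close>), two such \<open>i\<close> give the same coalgebra exactly if they differ by an
  invertible 2-cell between their domains (\<open>coaction_precompose_iso\<close>, \<open>coaction_eq_iso\<close>), and such an
  \<open>i\<close> is automatically monic (\<open>transpose_invertible_mono\<close>). Moreover \<open>m \<cdot> (S \<diamondop> i)\<close> is \<open>f' \<diamondop> \<xi> i\<close> up to
  associativity, and \<open>f' \<star> -\<close> reflects the invertibility of \<open>\<xi> i\<close> (\<open>U_reflects_iso\<close>). So the
  elements of the monoid of invertible subobjects are the fibres of \<open>coact\<close> on the \<open>i\<close> with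
  invertible \<open>\<xi> i\<close> (\<open>left_invertible_iff\<close>, \<open>sub_eq_coact_fibre\<close>).

  On the other side, precomposition with \<open>f'\<close> is left adjoint to precomposition with \<open>f\<close>, so a
  2-cell \<open>\<phi> : f \<star> f' \<rightarrow> f \<star> f'\<close> is the same as a 2-cell \<open>f \<rightarrow> f \<star> (f' \<star> f)\<close>, its mate, and the
  2-cell \<open>\<theta>\<close> of the theorem inverts this correspondence (\<open>mate_\<theta>\<close>, \<open>\<theta>_mate\<close>). The mate satisfies
  the counit law of a coalgebra iff \<open>\<phi>\<close> preserves the counit of the comonoid (\<open>counit_iff\<close>), and it is
  coassociative iff \<open>\<phi>\<close> preserves the comultiplication (\<open>coassoc_iff\<close>, \<open>comult_iff\<close>).

  Multiplicativity rests on \<open>\<xi> (m \<cdot> (i \<diamondop> j)) = \<xi> j \<cdot> (\<xi> i \<diamondop> h)\<close> (\<open>\<xi>_product\<close>, with \<open>h\<close> the domain of \<open>j\<close>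
  and up to associativity), from which the coalgebra of a product is computed (\<open>coact_product\<close>).
  That formula also shows that the product of two classes depends only on their coalgebras; so it is
  well defined, and the monoid laws for subobjects follow from those for endomorphisms along the
  bijection.
\<close>

section \<open>Categories\<close>

context category
begin

lemma Hom_iff: "k \<in> Hom C x y \<longleftrightarrow> k \<in> Ar C \<and> Dom C k = x \<and> Cod C k = y"
  by (auto simp: Hom_def)

lemma Dom_in [simp]: "k \<in> Ar C \<Longrightarrow> Dom C k \<in> Ob C"
  and Cod_in [simp]: "k \<in> Ar C \<Longrightarrow> Cod C k \<in> Ob C"
  by (simp_all add: Dom_Ob Cod_Ob)

lemma Id_arr [simp]:
  assumes "x \<in> Ob C"
  shows "Id C x \<in> Ar C" "Dom C (Id C x) = x" "Cod C (Id C x) = x"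
  using Id_Hom[OF assms] by (auto simp: Hom_iff)

lemma Cmp_arr [simp]:
  assumes "k \<in> Ar C" "l \<in> Ar C" "Dom C l = Cod C k"
  shows "Cmp C l k \<in> Ar C" "Dom C (Cmp C l k) = Dom C k" "Cod C (Cmp C l k) = Cod C l"
  using Cmp_Hom[of k "Dom C k" "Cod C k" l "Cod C l"] assms by (auto simp: Hom_iff)

lemma Cmp_Id [simp]:
  assumes "k \<in> Ar C"
  shows "Cod C k = y \<Longrightarrow> Cmp C (Id C y) k = k" "Dom C k = x \<Longrightarrow> Cmp C k (Id C x) = k"
  using Cmp_Id_left[of k "Dom C k" "Cod C k"] Cmp_Id_right[of k "Dom C k" "Cod C k"] assms
  by (auto simp: Hom_iff)

lemma assoc:
  assumes "k \<in> Ar C" "l \<in> Ar C" "m \<in> Ar C" "Dom C l = Cod C k" "Dom C m = Cod C l"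
  shows "Cmp C (Cmp C m l) k = Cmp C m (Cmp C l k)"
  using Cmp_assoc[of k "Dom C k" "Cod C k" l "Cod C l" m "Cod C m"] assms by (auto simp: Hom_iff)

text \<open>Composites are kept nested to the right. An equation between composites of two arrows then has to be
  applied in front of a further arrow \<open>x\<close>; the next two rules turn it into a rewrite rule for that
  situation.\<close>

lemma Cmp_extend:
  assumes "Cmp C l k = m" "k \<in> Ar C" "l \<in> Ar C" "x \<in> Ar C" "Dom C l = Cod C k" "Dom C k = Cod C x"
  shows "Cmp C l (Cmp C k x) = Cmp C m x"
  using assms assoc by force

lemma Cmp_extend2:
  assumes "Cmp C l k = Cmp C m n" "k \<in> Ar C" "l \<in> Ar C" "x \<in> Ar C" "m \<in> Ar C" "n \<in> Ar C"
    "Dom C l = Cod C k" "Dom C k = Cod C x" "Dom C m = Cod C n" "Dom C n = Cod C x"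
  shows "Cmp C l (Cmp C k x) = Cmp C m (Cmp C n x)"
  using Cmp_extend[OF assms(1-4)] assms by (simp add: assoc)

lemma inverse_arrows_unique:
  assumes "inverse_arrows C k l" "inverse_arrows C k l'"
  shows "l = l'"
proof -
  have *: "k \<in> Ar C" "l \<in> Ar C" "l' \<in> Ar C" "Dom C l = Cod C k" "Cod C l = Dom C k"
    "Dom C l' = Cod C k" "Cod C l' = Dom C k"
    using assms by (auto simp: inverse_arrows_def Hom_iff)
  have "l = Cmp C l (Cmp C k l')" using assms * by (simp add: inverse_arrows_def)
  also have "\<dots> = Cmp C (Cmp C l k) l'" using * by (simp add: assoc)
  also have "\<dots> = l'" using assms * by (simp add: inverse_arrows_def)
  finally show ?thesis .
qed

lemma Inv_eq: "inverse_arrows C k l \<Longrightarrow> Inv C k = l"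
  unfolding Inv_def using inverse_arrows_unique by blast

lemma iso_arr: "is_isomorphism C k \<Longrightarrow> k \<in> Ar C"
  by (auto simp: is_isomorphism_def inverse_arrows_def)

lemma inverse_arrows_Inv: "is_isomorphism C k \<Longrightarrow> inverse_arrows C k (Inv C k)"
  using Inv_eq by (auto simp: is_isomorphism_def)

lemma Inv_arr [simp]:
  assumes "is_isomorphism C k"
  shows "Inv C k \<in> Ar C" "Dom C (Inv C k) = Cod C k" "Cod C (Inv C k) = Dom C k"
    "Cmp C (Inv C k) k = Id C (Dom C k)" "Cmp C k (Inv C k) = Id C (Cod C k)"
  using inverse_arrows_Inv[OF assms] by (auto simp: inverse_arrows_def Hom_iff)

lemma Inv_cancel [simp]:
  assumes "is_isomorphism C k" "x \<in> Ar C"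
  shows "Cod C x = Dom C k \<Longrightarrow> Cmp C (Inv C k) (Cmp C k x) = x"
    "Cod C x = Cod C k \<Longrightarrow> Cmp C k (Cmp C (Inv C k) x) = x"
  using assms iso_arr[OF assms(1)] by (simp_all flip: assoc)

lemma isoI:
  assumes "k \<in> Ar C" "l \<in> Ar C" "Dom C l = Cod C k" "Cod C l = Dom C k"
    "Cmp C l k = Id C (Dom C k)" "Cmp C k l = Id C (Cod C k)"
  shows "is_isomorphism C k" "Inv C k = l"
proof -
  have "inverse_arrows C k l" using assms by (auto simp: inverse_arrows_def Hom_iff)
  then show "is_isomorphism C k" "Inv C k = l" by (auto simp: is_isomorphism_def Inv_eq)
qed

lemma iso_Inv [simp]:
  assumes "is_isomorphism C k"
  shows "is_isomorphism C (Inv C k)"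
  by (rule isoI(1)[where l = k]) (use assms iso_arr[OF assms] in simp_all)

lemma iso_Cmp:
  assumes "is_isomorphism C k" "is_isomorphism C l" "Dom C l = Cod C k"
  shows "is_isomorphism C (Cmp C l k)" "Inv C (Cmp C l k) = Cmp C (Inv C k) (Inv C l)"
proof -
  note [simp] = iso_arr[OF assms(1)] iso_arr[OF assms(2)]
  have *: "Cmp C (Cmp C (Inv C k) (Inv C l)) (Cmp C l k) = Id C (Dom C k)"
    "Cmp C (Cmp C l k) (Cmp C (Inv C k) (Inv C l)) = Id C (Cod C l)"
    using assms by (simp_all add: assoc)
  show "is_isomorphism C (Cmp C l k)" "Inv C (Cmp C l k) = Cmp C (Inv C k) (Inv C l)"
    by (rule isoI[where l = "Cmp C (Inv C k) (Inv C l)"]; use assms * in simp)+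
qed

lemma iso_Id [simp]: "x \<in> Ob C \<Longrightarrow> is_isomorphism C (Id C x)"
  by (rule isoI(1)[where l = "Id C x"]) simp_all

lemma iso_cancel_left:
  assumes "is_isomorphism C k" "x \<in> Ar C" "y \<in> Ar C" "Cod C x = Dom C k" "Cod C y = Dom C k"
    "Cmp C k x = Cmp C k y"
  shows "x = y"
proof -
  have "x = Cmp C (Inv C k) (Cmp C k x)" using Inv_cancel(1)[OF assms(1,2,4)] by (rule sym)
  also have "\<dots> = y" unfolding assms(6) by (rule Inv_cancel(1)[OF assms(1,3,5)])
  finally show ?thesis .
qed

lemma iso_cancel_right:
  assumes "is_isomorphism C k" "x \<in> Ar C" "y \<in> Ar C" "Dom C x = Cod C k" "Dom C y = Cod C k"
    "Cmp C x k = Cmp C y k"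
  shows "x = y"
proof -
  have "Cmp C (Cmp C x k) (Inv C k) = x" "Cmp C (Cmp C y k) (Inv C k) = y"
    using assms(1-5) iso_arr[OF assms(1)] by (simp_all add: assoc)
  then show ?thesis unfolding assms(6) by (rule trans[OF sym])
qed

lemma Inv_move_left:
  assumes "is_isomorphism C k" "x \<in> Ar C" "Cod C x = Dom C k" "Cmp C k x = y"
  shows "x = Cmp C (Inv C k) y"
  using Inv_cancel(1)[OF assms(1,2,3), symmetric] unfolding assms(4) .

lemma Inv_move_right:
  assumes "is_isomorphism C k" "x \<in> Ar C" "Dom C x = Cod C k" "Cmp C x k = y"
  shows "x = Cmp C y (Inv C k)"
  using assms(1-3) iso_arr[OF assms(1)] unfolding assms(4)[symmetric] by (simp add: assoc)

end

section \<open>Bicategories\<close>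

sublocale bicategory \<subseteq> V: category "Vert B"
  by (rule Vert_category)

context bicategory
begin

abbreviation "ob x \<equiv> x \<in> Ob (Vert B)"
abbreviation "ar \<tau> \<equiv> \<tau> \<in> Ar (Vert B)"
abbreviation "dom\<^sub>2 \<equiv> Dom (Vert B)"
abbreviation "cod\<^sub>2 \<equiv> Cod (Vert B)"
abbreviation "iso\<^sub>2 \<equiv> is_isomorphism (Vert B)"

lemma Src_Trg_Cells [simp]: "ob x \<Longrightarrow> Src B x \<in> Cells B" "ob x \<Longrightarrow> Trg B x \<in> Cells B"
  by (simp_all add: Src_Cells Trg_Cells)

lemma Src_Trg_cod [simp]:
  "ar \<tau> \<Longrightarrow> Src B (cod\<^sub>2 \<tau>) = Src B (dom\<^sub>2 \<tau>)" "ar \<tau> \<Longrightarrow> Trg B (cod\<^sub>2 \<tau>) = Trg B (dom\<^sub>2 \<tau>)"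
  using parallel_Src[of \<tau> "dom\<^sub>2 \<tau>" "cod\<^sub>2 \<tau>"] parallel_Trg[of \<tau> "dom\<^sub>2 \<tau>" "cod\<^sub>2 \<tau>"]
  by (simp_all add: V.Hom_iff)

lemma Unit_ob [simp]:
  assumes "x \<in> Cells B"
  shows "ob (Unit B x)" "Src B (Unit B x) = x" "Trg B (Unit B x) = x"
  using Unit_Hom1[OF assms] by (auto simp: cells1_def)

lemma HC1_ob [simp]:
  assumes "ob f" "ob g" "Src B g = Trg B f"
  shows "ob (g \<star> f)" "Src B (g \<star> f) = Src B f" "Trg B (g \<star> f) = Trg B g"
  using HC1_Hom1[of f "Src B f" "Trg B f" g "Trg B g"] assms by (auto simp: cells1_def)

lemma HC2_ar [simp]:
  assumes "ar \<sigma>" "ar \<tau>" "Src B (dom\<^sub>2 \<tau>) = Trg B (dom\<^sub>2 \<sigma>)"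
  shows "ar (\<tau> \<diamondop> \<sigma>)" "dom\<^sub>2 (\<tau> \<diamondop> \<sigma>) = dom\<^sub>2 \<tau> \<star> dom\<^sub>2 \<sigma>" "cod\<^sub>2 (\<tau> \<diamondop> \<sigma>) = cod\<^sub>2 \<tau> \<star> cod\<^sub>2 \<sigma>"
  using HC2_Hom2[of "dom\<^sub>2 \<sigma>" "Src B (dom\<^sub>2 \<sigma>)" "Trg B (dom\<^sub>2 \<sigma>)" "dom\<^sub>2 \<tau>" "Trg B (dom\<^sub>2 \<tau>)" \<sigma> "cod\<^sub>2 \<sigma>" \<tau> "cod\<^sub>2 \<tau>"]
    assms by (auto simp: cells1_def V.Hom_iff)

lemma HC2_Id [simp]:
  assumes "ob f" "ob g" "Src B g = Trg B f"
  shows "\<iota> g \<diamondop> \<iota> f = \<iota> (g \<star> f)"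
  using HC2_id[of f "Src B f" "Trg B f" g "Trg B g"] assms by (auto simp: cells1_def)

lemma interchange_eq:
  assumes "ar \<sigma>" "ar \<sigma>'" "ar \<tau>" "ar \<tau>'" "dom\<^sub>2 \<sigma>' = cod\<^sub>2 \<sigma>" "dom\<^sub>2 \<tau>' = cod\<^sub>2 \<tau>"
    "Src B (dom\<^sub>2 \<tau>) = Trg B (dom\<^sub>2 \<sigma>)"
  shows "(\<tau>' \<diamondop> \<sigma>') \<cdot> (\<tau> \<diamondop> \<sigma>) = (\<tau>' \<cdot> \<tau>) \<diamondop> (\<sigma>' \<cdot> \<sigma>)"
  using interchange[of "dom\<^sub>2 \<sigma>" "Src B (dom\<^sub>2 \<sigma>)" "Trg B (dom\<^sub>2 \<sigma>)" "dom\<^sub>2 \<tau>" "Trg B (dom\<^sub>2 \<tau>)"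
      \<sigma> "cod\<^sub>2 \<sigma>" \<sigma>' "cod\<^sub>2 \<sigma>'" \<tau> "cod\<^sub>2 \<tau>" \<tau>' "cod\<^sub>2 \<tau>'"]
    assms by (auto simp: cells1_def V.Hom_iff)

lemma whisker_left:
  assumes "ar \<sigma>" "ar \<tau>" "ob g" "dom\<^sub>2 \<tau> = cod\<^sub>2 \<sigma>" "Src B g = Trg B (dom\<^sub>2 \<sigma>)"
  shows "\<iota> g \<diamondop> (\<tau> \<cdot> \<sigma>) = (\<iota> g \<diamondop> \<tau>) \<cdot> (\<iota> g \<diamondop> \<sigma>)"
  using assms by (simp add: interchange_eq)

lemma whisker_right:
  assumes "ar \<sigma>" "ar \<tau>" "ob g" "dom\<^sub>2 \<tau> = cod\<^sub>2 \<sigma>" "Trg B g = Src B (dom\<^sub>2 \<sigma>)"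
  shows "(\<tau> \<cdot> \<sigma>) \<diamondop> \<iota> g = (\<tau> \<diamondop> \<iota> g) \<cdot> (\<sigma> \<diamondop> \<iota> g)"
  using assms by (simp add: interchange_eq)

text \<open>The two ways of splitting a horizontal composite into whiskerings; used in both directions to move
  2-cells on different sides past each other.\<close>

lemma slide:
  assumes "ar \<sigma>" "ar \<tau>" "Src B (dom\<^sub>2 \<tau>) = Trg B (dom\<^sub>2 \<sigma>)" "x = dom\<^sub>2 \<tau>" "y = cod\<^sub>2 \<tau>" "z = dom\<^sub>2 \<sigma>" "w = cod\<^sub>2 \<sigma>"
  shows "(\<iota> y \<diamondop> \<sigma>) \<cdot> (\<tau> \<diamondop> \<iota> z) = \<tau> \<diamondop> \<sigma>" "(\<tau> \<diamondop> \<iota> w) \<cdot> (\<iota> x \<diamondop> \<sigma>) = \<tau> \<diamondop> \<sigma>"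
  using assms by (simp_all add: interchange_eq)

lemma iso_HC2:
  assumes "iso\<^sub>2 \<sigma>" "iso\<^sub>2 \<tau>" "Src B (dom\<^sub>2 \<tau>) = Trg B (dom\<^sub>2 \<sigma>)"
  shows "iso\<^sub>2 (\<tau> \<diamondop> \<sigma>)" "vinv (\<tau> \<diamondop> \<sigma>) = vinv \<tau> \<diamondop> vinv \<sigma>"
proof -
  note [simp] = V.iso_arr[OF assms(1)] V.iso_arr[OF assms(2)]
  show "iso\<^sub>2 (\<tau> \<diamondop> \<sigma>)" "vinv (\<tau> \<diamondop> \<sigma>) = vinv \<tau> \<diamondop> vinv \<sigma>"
    by (rule V.isoI[where l = "vinv \<tau> \<diamondop> vinv \<sigma>"]; use assms in \<open>simp add: interchange_eq\<close>)+
qed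

lemma Inv_Id [simp]: "ob x \<Longrightarrow> vinv (\<iota> x) = \<iota> x"
  by (rule V.isoI(2)) simp_all

lemma iso_whisker [simp]:
  assumes "iso\<^sub>2 \<tau>" "ob x"
  shows "Src B x = Trg B (dom\<^sub>2 \<tau>) \<Longrightarrow> iso\<^sub>2 (\<iota> x \<diamondop> \<tau>)"
    "Src B x = Trg B (dom\<^sub>2 \<tau>) \<Longrightarrow> vinv (\<iota> x \<diamondop> \<tau>) = \<iota> x \<diamondop> vinv \<tau>"
    "Trg B x = Src B (dom\<^sub>2 \<tau>) \<Longrightarrow> iso\<^sub>2 (\<tau> \<diamondop> \<iota> x)"
    "Trg B x = Src B (dom\<^sub>2 \<tau>) \<Longrightarrow> vinv (\<tau> \<diamondop> \<iota> x) = vinv \<tau> \<diamondop> \<iota> x"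
  using assms by (simp_all add: iso_HC2)

lemma Assoc_ar [simp]:
  assumes "ob f" "ob g" "ob h" "Src B h = Trg B g" "Src B g = Trg B f"
  shows "ar (\<a> h g f)" "dom\<^sub>2 (\<a> h g f) = (h \<star> g) \<star> f" "cod\<^sub>2 (\<a> h g f) = h \<star> (g \<star> f)" "iso\<^sub>2 (\<a> h g f)"
  using Assoc_Hom2[of f "Src B f" "Trg B f" g "Trg B g" h "Trg B h"]
    Assoc_iso[of f "Src B f" "Trg B f" g "Trg B g" h "Trg B h"] assms
  by (auto simp: cells1_def V.Hom_iff)

lemma Assoc_nat:
  assumes "ar \<rho>" "ar \<sigma>" "ar \<tau>" "Src B (dom\<^sub>2 \<tau>) = Trg B (dom\<^sub>2 \<sigma>)" "Src B (dom\<^sub>2 \<sigma>) = Trg B (dom\<^sub>2 \<rho>)"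
  shows "\<a> (cod\<^sub>2 \<tau>) (cod\<^sub>2 \<sigma>) (cod\<^sub>2 \<rho>) \<cdot> ((\<tau> \<diamondop> \<sigma>) \<diamondop> \<rho>) = (\<tau> \<diamondop> (\<sigma> \<diamondop> \<rho>)) \<cdot> \<a> (dom\<^sub>2 \<tau>) (dom\<^sub>2 \<sigma>) (dom\<^sub>2 \<rho>)"
  using Assoc_natural[of "dom\<^sub>2 \<rho>" "Src B (dom\<^sub>2 \<rho>)" "Trg B (dom\<^sub>2 \<rho>)" "dom\<^sub>2 \<sigma>" "Trg B (dom\<^sub>2 \<sigma>)" "dom\<^sub>2 \<tau>" "Trg B (dom\<^sub>2 \<tau>)"
     \<rho> "cod\<^sub>2 \<rho>" \<sigma> "cod\<^sub>2 \<sigma>" \<tau> "cod\<^sub>2 \<tau>"] assms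
  by (auto simp: cells1_def V.Hom_iff)

lemma Lunit_ar [simp]:
  assumes "ob f"
  shows "ar (\<l> f)" "dom\<^sub>2 (\<l> f) = Unit B (Trg B f) \<star> f" "cod\<^sub>2 (\<l> f) = f" "iso\<^sub>2 (\<l> f)"
  using Lunit_Hom2[of f "Src B f" "Trg B f"] Lunit_iso[of f "Src B f" "Trg B f"] assms
  by (auto simp: cells1_def V.Hom_iff)

lemma Runit_ar [simp]:
  assumes "ob f"
  shows "ar (\<r> f)" "dom\<^sub>2 (\<r> f) = f \<star> Unit B (Src B f)" "cod\<^sub>2 (\<r> f) = f" "iso\<^sub>2 (\<r> f)"
  using Runit_Hom2[of f "Src B f" "Trg B f"] Runit_iso[of f "Src B f" "Trg B f"] assms
  by (auto simp: cells1_def V.Hom_iff)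

lemma Lunit_nat:
  assumes "ar \<sigma>" "x = Trg B (dom\<^sub>2 \<sigma>)" "y = cod\<^sub>2 \<sigma>"
  shows "\<l> y \<cdot> (\<iota> (Unit B x) \<diamondop> \<sigma>) = \<sigma> \<cdot> \<l> (dom\<^sub>2 \<sigma>)"
  using Lunit_natural[of "dom\<^sub>2 \<sigma>" "Src B (dom\<^sub>2 \<sigma>)" "Trg B (dom\<^sub>2 \<sigma>)" \<sigma> "cod\<^sub>2 \<sigma>"] assms
  by (auto simp: cells1_def V.Hom_iff)

lemma Runit_nat:
  assumes "ar \<sigma>" "x = Src B (dom\<^sub>2 \<sigma>)" "y = cod\<^sub>2 \<sigma>"
  shows "\<r> y \<cdot> (\<sigma> \<diamondop> \<iota> (Unit B x)) = \<sigma> \<cdot> \<r> (dom\<^sub>2 \<sigma>)"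
  using Runit_natural[of "dom\<^sub>2 \<sigma>" "Src B (dom\<^sub>2 \<sigma>)" "Trg B (dom\<^sub>2 \<sigma>)" \<sigma> "cod\<^sub>2 \<sigma>"] assms
  by (auto simp: cells1_def V.Hom_iff)

lemma triangle_eq:
  assumes "ob f" "ob g" "Src B g = Trg B f" "x = Src B g"
  shows "(\<iota> g \<diamondop> \<l> f) \<cdot> \<a> g (Unit B x) f = \<r> g \<diamondop> \<iota> f"
  using triangle[of f "Src B f" "Trg B f" g "Trg B g"] assms by (auto simp: cells1_def)

lemma pentagon_eq:
  assumes "ob e" "ob f" "ob g" "ob h" "Src B f = Trg B e" "Src B g = Trg B f" "Src B h = Trg B g"
  shows "(\<iota> h \<diamondop> \<a> g f e) \<cdot> \<a> h (g \<star> f) e \<cdot> (\<a> h g f \<diamondop> \<iota> e) = \<a> h g (f \<star> e) \<cdot> \<a> (h \<star> g) f e"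
  using pentagon[of e "Src B e" "Trg B e" f "Trg B f" g "Trg B g" h "Trg B h"] assms
  by (auto simp: cells1_def)

text \<open>The codomains are variables here because, once computed, they no longer have the syntactic form
  \<open>cod\<^sub>2 \<tau>\<close>.\<close>

lemma Assoc_nat_at:
  assumes "ar \<rho>" "ar \<sigma>" "ar \<tau>" "Src B (dom\<^sub>2 \<tau>) = Trg B (dom\<^sub>2 \<sigma>)" "Src B (dom\<^sub>2 \<sigma>) = Trg B (dom\<^sub>2 \<rho>)"
    "x = cod\<^sub>2 \<tau>" "y = cod\<^sub>2 \<sigma>" "z = cod\<^sub>2 \<rho>"
  shows "\<a> x y z \<cdot> ((\<tau> \<diamondop> \<sigma>) \<diamondop> \<rho>) = (\<tau> \<diamondop> (\<sigma> \<diamondop> \<rho>)) \<cdot> \<a> (dom\<^sub>2 \<tau>) (dom\<^sub>2 \<sigma>) (dom\<^sub>2 \<rho>)"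
  using Assoc_nat[OF assms(1-5)] assms(6-8) by simp

text \<open>Whiskered forms of naturality. Identity 2-cells of composites are normalised to
  \<open>\<iota> (h \<star> g)\<close>, so that the general form no longer matches them. The primed versions rewrite in front
  of a further 2-cell.\<close>

lemma Assoc_nat_right:
  assumes "ar \<rho>" "ob g" "ob h" "Src B h = Trg B g" "Src B g = Trg B (dom\<^sub>2 \<rho>)" "y = cod\<^sub>2 \<rho>"
  shows "\<a> h g y \<cdot> (\<iota> (h \<star> g) \<diamondop> \<rho>) = (\<iota> h \<diamondop> (\<iota> g \<diamondop> \<rho>)) \<cdot> \<a> h g (dom\<^sub>2 \<rho>)"
  using Assoc_nat[of \<rho> "\<iota> g" "\<iota> h"] assms by simp

lemma Assoc_nat_middle:
  assumes "ar \<sigma>" "ob f" "ob h" "Src B h = Trg B (dom\<^sub>2 \<sigma>)" "Src B (dom\<^sub>2 \<sigma>) = Trg B f" "y = cod\<^sub>2 \<sigma>"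
  shows "\<a> h y f \<cdot> ((\<iota> h \<diamondop> \<sigma>) \<diamondop> \<iota> f) = (\<iota> h \<diamondop> (\<sigma> \<diamondop> \<iota> f)) \<cdot> \<a> h (dom\<^sub>2 \<sigma>) f"
  using Assoc_nat[of "\<iota> f" \<sigma> "\<iota> h"] assms by simp

lemma Assoc_nat_left:
  assumes "ar \<tau>" "ob f" "ob g" "Src B (dom\<^sub>2 \<tau>) = Trg B g" "Src B g = Trg B f" "y = cod\<^sub>2 \<tau>"
  shows "\<a> y g f \<cdot> ((\<tau> \<diamondop> \<iota> g) \<diamondop> \<iota> f) = (\<tau> \<diamondop> \<iota> (g \<star> f)) \<cdot> \<a> (dom\<^sub>2 \<tau>) g f"
  using Assoc_nat[of "\<iota> f" "\<iota> g" \<tau>] assms by simp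

lemmas Assoc_nat_right' = Assoc_nat_right[THEN V.Cmp_extend2]
lemmas Assoc_nat_middle' = Assoc_nat_middle[THEN V.Cmp_extend2]
lemmas Assoc_nat_left' = Assoc_nat_left[THEN V.Cmp_extend2]

lemma pentagon_extend:
  assumes "ob e" "ob f" "ob g" "ob h" "Src B f = Trg B e" "Src B g = Trg B f" "Src B h = Trg B g"
    "ar x" "cod\<^sub>2 x = ((h \<star> g) \<star> f) \<star> e"
  shows "(\<iota> h \<diamondop> \<a> g f e) \<cdot> \<a> h (g \<star> f) e \<cdot> (\<a> h g f \<diamondop> \<iota> e) \<cdot> x = \<a> h g (f \<star> e) \<cdot> \<a> (h \<star> g) f e \<cdot> x"
  using pentagon_eq[OF assms(1-7), THEN arg_cong[where f = "\<lambda>y. y \<cdot> x"]] assms by (simp add: V.assoc)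

text \<open>Whiskering with a unit 1-cell is isomorphic to the identity functor by naturality of the unit
  constraint.\<close>

lemma Lunit_faithful:
  assumes "ar \<sigma>" "ar \<tau>" "dom\<^sub>2 \<sigma> = dom\<^sub>2 \<tau>" "cod\<^sub>2 \<sigma> = cod\<^sub>2 \<tau>" "x = Trg B (dom\<^sub>2 \<sigma>)"
    "\<iota> (Unit B x) \<diamondop> \<sigma> = \<iota> (Unit B x) \<diamondop> \<tau>"
  shows "\<sigma> = \<tau>"
  by (rule V.iso_cancel_right[where k = "\<l> (dom\<^sub>2 \<sigma>)"])
     (use assms Lunit_nat[of \<sigma> x "cod\<^sub>2 \<sigma>"] Lunit_nat[of \<tau> x "cod\<^sub>2 \<tau>"] in simp_all)

lemma Runit_faithful:
  assumes "ar \<sigma>" "ar \<tau>" "dom\<^sub>2 \<sigma> = dom\<^sub>2 \<tau>" "cod\<^sub>2 \<sigma> = cod\<^sub>2 \<tau>" "x = Src B (dom\<^sub>2 \<sigma>)"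
    "\<sigma> \<diamondop> \<iota> (Unit B x) = \<tau> \<diamondop> \<iota> (Unit B x)"
  shows "\<sigma> = \<tau>"
  by (rule V.iso_cancel_right[where k = "\<r> (dom\<^sub>2 \<sigma>)"])
     (use assms Runit_nat[of \<sigma> x "cod\<^sub>2 \<sigma>"] Runit_nat[of \<tau> x "cod\<^sub>2 \<tau>"] in simp_all)

text \<open>Kelly's redundancy of the unit axioms. Whisker both sides with the unit \<open>u\<close>, which is faithful: two
  instances of the triangle axiom, linked by the pentagon for \<open>g, f, u, u\<close>, give the equation.\<close>

lemma Runit_HC1:
  assumes [simp]: "ob f" "ob g" "Src B g = Trg B f" and x: "x = Src B f"
  shows "(\<iota> g \<diamondop> \<r> f) \<cdot> \<a> g f (Unit B x) = \<r> (g \<star> f)"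
proof -
  let ?u = "Unit B (Src B f)"
  have "\<a> g f ?u \<cdot> (\<r> (g \<star> f) \<diamondop> \<iota> ?u) = \<a> g f ?u \<cdot> (\<iota> (g \<star> f) \<diamondop> \<l> ?u) \<cdot> \<a> (g \<star> f) ?u ?u"
    by (simp add: triangle_eq[of ?u "g \<star> f" "Src B f"])
  also have "\<dots> = (\<iota> g \<diamondop> (\<iota> f \<diamondop> \<l> ?u)) \<cdot> \<a> g f (?u \<star> ?u) \<cdot> \<a> (g \<star> f) ?u ?u"
    by (simp add: Assoc_nat_right[of "\<l> ?u" f g ?u, THEN V.Cmp_extend2])
  also have "\<dots> = (\<iota> g \<diamondop> (\<iota> f \<diamondop> \<l> ?u)) \<cdot> (\<iota> g \<diamondop> \<a> f ?u ?u) \<cdot> \<a> g (f \<star> ?u) ?u \<cdot> (\<a> g f ?u \<diamondop> \<iota> ?u)"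
    by (simp add: pentagon_eq[of ?u ?u f g])
  also have "\<dots> = (\<iota> g \<diamondop> (\<r> f \<diamondop> \<iota> ?u)) \<cdot> \<a> g (f \<star> ?u) ?u \<cdot> (\<a> g f ?u \<diamondop> \<iota> ?u)"
    by (simp add: triangle_eq[of ?u f "Src B f"] interchange_eq[of "\<a> f ?u ?u" "\<iota> f \<diamondop> \<l> ?u" "\<iota> g" "\<iota> g", THEN V.Cmp_extend])
  also have "\<dots> = \<a> g f ?u \<cdot> ((\<iota> g \<diamondop> \<r> f) \<diamondop> \<iota> ?u) \<cdot> (\<a> g f ?u \<diamondop> \<iota> ?u)"
    by (simp add: Assoc_nat_middle[of "\<r> f" ?u g f, THEN V.Cmp_extend2])
  also have "\<dots> = \<a> g f ?u \<cdot> (((\<iota> g \<diamondop> \<r> f) \<cdot> \<a> g f ?u) \<diamondop> \<iota> ?u)"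
    by (simp add: interchange_eq)
  finally have "\<a> g f ?u \<cdot> (\<r> (g \<star> f) \<diamondop> \<iota> ?u) = \<dots>" .
  then have "\<r> (g \<star> f) \<diamondop> \<iota> ?u = ((\<iota> g \<diamondop> \<r> f) \<cdot> \<a> g f ?u) \<diamondop> \<iota> ?u"
    by (rule V.iso_cancel_left[rotated -1]) simp_all
  then have "\<r> (g \<star> f) = (\<iota> g \<diamondop> \<r> f) \<cdot> \<a> g f ?u"
    by (rule Runit_faithful[rotated -1]) simp_all
  then show ?thesis by (simp add: x)
qed

text \<open>The mirror image of the previous lemma, from the pentagon for \<open>u, u, g, f\<close>.\<close>

lemma Lunit_HC1:
  assumes [simp]: "ob f" "ob g" "Src B g = Trg B f" and x: "x = Trg B g"
  shows "\<l> (g \<star> f) \<cdot> \<a> (Unit B x) g f = \<l> g \<diamondop> \<iota> f"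
proof -
  let ?u = "Unit B (Trg B g)"
  let ?p = "\<a> ?u (?u \<star> g) f \<cdot> (\<a> ?u ?u g \<diamondop> \<iota> f)"
  have "(\<iota> ?u \<diamondop> (\<l> (g \<star> f) \<cdot> \<a> ?u g f)) \<cdot> ?p = (\<iota> ?u \<diamondop> \<l> (g \<star> f)) \<cdot> \<a> ?u ?u (g \<star> f) \<cdot> \<a> (?u \<star> ?u) g f"
    by (simp add: pentagon_eq[of f g ?u ?u] whisker_left V.assoc)
  also have "\<dots> = (\<r> ?u \<diamondop> \<iota> (g \<star> f)) \<cdot> \<a> (?u \<star> ?u) g f"
    by (simp add: triangle_eq[of "g \<star> f" ?u "Trg B g", THEN V.Cmp_extend])
  also have "\<dots> = \<a> ?u g f \<cdot> ((\<r> ?u \<diamondop> \<iota> g) \<diamondop> \<iota> f)"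
    by (simp add: Assoc_nat_left[of "\<r> ?u" f g ?u])
  also have "\<dots> = \<a> ?u g f \<cdot> ((\<iota> ?u \<diamondop> \<l> g) \<diamondop> \<iota> f) \<cdot> (\<a> ?u ?u g \<diamondop> \<iota> f)"
    by (simp add: triangle_eq[of g ?u "Trg B g"] interchange_eq)
  also have "\<dots> = (\<iota> ?u \<diamondop> (\<l> g \<diamondop> \<iota> f)) \<cdot> ?p"
    by (simp add: Assoc_nat_middle[of "\<l> g" f ?u g, THEN V.Cmp_extend2])
  finally have "\<iota> ?u \<diamondop> (\<l> (g \<star> f) \<cdot> \<a> ?u g f) = \<iota> ?u \<diamondop> (\<l> g \<diamondop> \<iota> f)"
    by (rule V.iso_cancel_right[rotated -1]) (simp_all add: V.iso_Cmp)
  then have "\<l> (g \<star> f) \<cdot> \<a> ?u g f = \<l> g \<diamondop> \<iota> f"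
    by (rule Lunit_faithful[rotated -1]) simp_all
  then show ?thesis by (simp add: x)
qed

text \<open>Computations in the hom-categories are reduced to \<open>Vert B\<close>, whose rules are set up for the simplifier.\<close>

lemma hom_cat_simps [simp]:
  "Ob (hom_cat B x y) = Hom1 x y" "Dom (hom_cat B x y) = dom\<^sub>2" "Cod (hom_cat B x y) = cod\<^sub>2"
  "Id (hom_cat B x y) = Id (Vert B)" "Cmp (hom_cat B x y) = Cmp (Vert B)"
  by (simp_all add: hom_cat_def)

lemma Hom1_iff: "k \<in> Hom1 x y \<longleftrightarrow> ob k \<and> Src B k = x \<and> Trg B k = y"
  by (auto simp: cells1_def)

lemma hom_cat_Ar_iff:
  "\<tau> \<in> Ar (hom_cat B x y) \<longleftrightarrow> ar \<tau> \<and> Src B (dom\<^sub>2 \<tau>) = x \<and> Trg B (dom\<^sub>2 \<tau>) = y"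
  by (auto simp: hom_cat_def Hom1_iff)

lemma hom_cat_Hom_iff:
  "\<tau> \<in> Hom (hom_cat B x y) k l \<longleftrightarrow> ar \<tau> \<and> dom\<^sub>2 \<tau> = k \<and> cod\<^sub>2 \<tau> = l \<and> Src B k = x \<and> Trg B k = y"
  by (auto simp: Hom_def hom_cat_Ar_iff)

lemma category_hom_cat: "category (hom_cat B x y)"
  by standard (auto simp: hom_cat_Hom_iff hom_cat_Ar_iff Hom1_iff V.assoc)

lemma hom_cat_inverse_iff:
  "inverse_arrows (hom_cat B x y) \<sigma> \<tau> \<longleftrightarrow> \<sigma> \<in> Ar (hom_cat B x y) \<and> inverse_arrows (Vert B) \<sigma> \<tau>"
  by (auto simp: inverse_arrows_def hom_cat_Hom_iff hom_cat_Ar_iff V.Hom_iff)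

lemma hom_cat_iso_iff:
  "is_isomorphism (hom_cat B x y) \<tau> \<longleftrightarrow> \<tau> \<in> Ar (hom_cat B x y) \<and> iso\<^sub>2 \<tau>"
  by (auto simp: is_isomorphism_def hom_cat_inverse_iff)

lemma hom_cat_Inv: "\<tau> \<in> Ar (hom_cat B x y) \<Longrightarrow> Inv (hom_cat B x y) \<tau> = vinv \<tau>"
  by (simp add: Inv_def hom_cat_inverse_iff)

end

section \<open>Functors and equivalences\<close>

lemma functor_simps:
  assumes "category C" "category D" "is_functor C D F"
  shows "\<And>x. x \<in> Ob C \<Longrightarrow> on_ob F x \<in> Ob D"
    and "\<And>k. k \<in> Ar C \<Longrightarrow> on_ar F k \<in> Ar D"
    and "\<And>k. k \<in> Ar C \<Longrightarrow> Dom D (on_ar F k) = on_ob F (Dom C k)"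
    and "\<And>k. k \<in> Ar C \<Longrightarrow> Cod D (on_ar F k) = on_ob F (Cod C k)"
    and "\<And>x. x \<in> Ob C \<Longrightarrow> on_ar F (Id C x) = Id D (on_ob F x)"
    and "\<And>k l. k \<in> Ar C \<Longrightarrow> l \<in> Ar C \<Longrightarrow> Dom C l = Cod C k \<Longrightarrow>
           on_ar F (Cmp C l k) = Cmp D (on_ar F l) (on_ar F k)"
proof -
  interpret C: category C by fact
  interpret D: category D by fact
  note F = assms(3)[unfolded is_functor_def]
  show "x \<in> Ob C \<Longrightarrow> on_ob F x \<in> Ob D" for x using F by blast
  have *: "on_ar F k \<in> Hom D (on_ob F (Dom C k)) (on_ob F (Cod C k))" if "k \<in> Ar C" for k
    using F that by (simp add: C.Hom_iff)
  show "k \<in> Ar C \<Longrightarrow> on_ar F k \<in> Ar D"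
    "k \<in> Ar C \<Longrightarrow> Dom D (on_ar F k) = on_ob F (Dom C k)"
    "k \<in> Ar C \<Longrightarrow> Cod D (on_ar F k) = on_ob F (Cod C k)" for k
    using *[of k] by (simp_all add: D.Hom_iff)
  show "x \<in> Ob C \<Longrightarrow> on_ar F (Id C x) = Id D (on_ob F x)" for x using F by blast
  show "on_ar F (Cmp C l k) = Cmp D (on_ar F l) (on_ar F k)"
    if "k \<in> Ar C" "l \<in> Ar C" "Dom C l = Cod C k" for k l
  proof -
    have "k \<in> Hom C (Dom C k) (Cod C k)" "l \<in> Hom C (Cod C k) (Cod C l)"
      using that by (simp_all add: C.Hom_iff)
    then show ?thesis using F that by (meson C.Dom_Ob C.Cod_Ob)
  qed
qed

lemma functor_iso:
  assumes "category C" "category D" "is_functor C D F" "is_isomorphism C k"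
  shows "is_isomorphism D (on_ar F k)"
    and "Inv D (on_ar F k) = on_ar F (Inv C k)"
proof -
  interpret C: category C by fact
  interpret D: category D by fact
  note [simp] = functor_simps[OF assms(1-3)] C.iso_arr[OF assms(4)]
  have "Cmp D (on_ar F (Inv C k)) (on_ar F k) = Id D (on_ob F (Dom C k))"
    "Cmp D (on_ar F k) (on_ar F (Inv C k)) = Id D (on_ob F (Cod C k))"
    using assms(4) by (simp_all flip: functor_simps(6)[OF assms(1-3)])
  then show "is_isomorphism D (on_ar F k)" "Inv D (on_ar F k) = on_ar F (Inv C k)"
    using assms(4) by (auto intro!: D.isoI)
qed

lemma nat_trans_simps:
  assumes "category C" "category D" "is_nat_trans C D F G t"
  shows "\<And>x. x \<in> Ob C \<Longrightarrow> t x \<in> Ar D"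
    and "\<And>x. x \<in> Ob C \<Longrightarrow> Dom D (t x) = on_ob F x"
    and "\<And>x. x \<in> Ob C \<Longrightarrow> Cod D (t x) = on_ob G x"
    and "\<And>k. k \<in> Ar C \<Longrightarrow> Cmp D (t (Cod C k)) (on_ar F k) = Cmp D (on_ar G k) (t (Dom C k))"
proof -
  interpret C: category C by fact
  interpret D: category D by fact
  note t = assms(3)[unfolded is_nat_trans_def]
  show "x \<in> Ob C \<Longrightarrow> t x \<in> Ar D" "x \<in> Ob C \<Longrightarrow> Dom D (t x) = on_ob F x"
    "x \<in> Ob C \<Longrightarrow> Cod D (t x) = on_ob G x" for x
    using t by (auto simp: D.Hom_iff)
  show "Cmp D (t (Cod C k)) (on_ar F k) = Cmp D (on_ar G k) (t (Dom C k))" if "k \<in> Ar C" for k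
    using t that by (simp add: C.Hom_iff)
qed

lemma (in category) is_functor_id: "is_functor C C id_func"
  by (auto simp: is_functor_def id_func_def)

lemma is_functor_comp:
  assumes "category C" "category D" "category E" "is_functor C D F" "is_functor D E G"
  shows "is_functor C E (comp_func G F)"
proof -
  interpret C: category C by fact
  interpret D: category D by fact
  interpret E: category E by fact
  show ?thesis
    using functor_simps[OF assms(1,2,4)] functor_simps[OF assms(2,3,5)]
    by (auto simp: is_functor_def comp_func_def C.Hom_iff D.Hom_iff E.Hom_iff)
qed

text \<open>By naturality of \<open>s\<close> an arrow is determined by its image under \<open>G K\<close>. This form applies to both
  functors of an equivalence.\<close>

lemma faithful_if_retract:
  assumes C: "category C" and E: "category E"
    and K: "is_functor C E K" and G: "is_functor E C G"
    and s: "is_nat_iso C C id_func (comp_func G K) s"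
    and k: "k \<in> Ar C" "l \<in> Ar C" "Dom C k = Dom C l" "Cod C k = Cod C l"
    and eq: "on_ar K k = on_ar K l"
  shows "k = l"
proof -
  interpret C: category C by fact
  have nt: "is_nat_trans C C id_func (comp_func G K) s" and iso: "\<And>x. x \<in> Ob C \<Longrightarrow> is_isomorphism C (s x)"
    using s by (auto simp: is_nat_iso_def)
  note s_simps = nat_trans_simps[OF C C nt]
  have "Cmp C (s (Cod C k)) k = Cmp C (s (Cod C k)) l"
    using s_simps(4)[OF k(1)] s_simps(4)[OF k(2)] k(3,4) eq by (simp add: id_func_def comp_func_def)
  then show ?thesis
    by (rule C.iso_cancel_left[OF iso, rotated -1]) (use k s_simps(1,2) in \<open>simp_all add: id_func_def\<close>)
qed

lemma equivalence_faithful: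
  assumes "category C" "category E" "is_equivalence C E K"
    "k \<in> Ar C" "l \<in> Ar C" "Dom C k = Dom C l" "Cod C k = Cod C l" "on_ar K k = on_ar K l"
  shows "k = l"
  using assms faithful_if_retract[of C E K] by (auto simp: is_equivalence_def)

lemma nat_iso_inverse:
  assumes C: "category C" and D: "category D" and F: "is_functor C D F" and G: "is_functor C D G"
    and t: "is_nat_iso C D F G t"
  shows "is_nat_iso C D G F (\<lambda>x. Inv D (t x))"
proof -
  interpret C: category C by fact
  interpret D: category D by fact
  have nt: "is_nat_trans C D F G t" and iso: "\<And>x. x \<in> Ob C \<Longrightarrow> is_isomorphism D (t x)"
    using t by (auto simp: is_nat_iso_def)
  note [simp] = nat_trans_simps(1-3)[OF C D nt] iso functor_simps[OF C D F] functor_simps[OF C D G]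
  have "Cmp D (Inv D (t (Cod C k))) (on_ar G k) = Cmp D (on_ar F k) (Inv D (t (Dom C k)))"
    if [simp]: "k \<in> Ar C" for k
  proof (rule D.iso_cancel_right[where k = "t (Dom C k)"])
    show "Cmp D (Cmp D (Inv D (t (Cod C k))) (on_ar G k)) (t (Dom C k)) =
        Cmp D (Cmp D (on_ar F k) (Inv D (t (Dom C k)))) (t (Dom C k))"
      by (simp add: D.assoc nat_trans_simps(4)[OF C D nt, symmetric])
  qed simp_all
  then show ?thesis
    by (auto simp: is_nat_iso_def is_nat_trans_def C.Hom_iff D.Hom_iff)
qed

text \<open>The preimage of \<open>g\<close> is \<open>G g\<close> conjugated by \<open>s\<close>; it is mapped to \<open>g\<close> because \<open>G\<close> is faithful as well.\<close>

lemma equivalence_full: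
  assumes C: "category C" and E: "category E" and eqv: "is_equivalence C E K"
    and x: "x \<in> Ob C" "y \<in> Ob C" and g: "g \<in> Hom E (on_ob K x) (on_ob K y)"
  shows "\<exists>k \<in> Hom C x y. on_ar K k = g"
proof -
  interpret C: category C by fact
  interpret E: category E by fact
  obtain G s t where K: "is_functor C E K" and G: "is_functor E C G"
    and s: "is_nat_iso C C id_func (comp_func G K) s" and t: "is_nat_iso E E (comp_func K G) id_func t"
    using eqv by (auto simp: is_equivalence_def)
  have nt: "is_nat_trans C C id_func (comp_func G K) s" and iso: "\<And>x. x \<in> Ob C \<Longrightarrow> is_isomorphism C (s x)"
    using s by (auto simp: is_nat_iso_def)
  note [simp] = iso functor_simps[OF C E K] functor_simps[OF E C G]
  have s_simps [simp]: "s z \<in> Ar C" "Dom C (s z) = z" "Cod C (s z) = on_ob G (on_ob K z)" if "z \<in> Ob C" for z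
    using nat_trans_simps[OF C C nt] that by (simp_all add: id_func_def comp_func_def)
  have [simp]: "g \<in> Ar E" "Dom E g = on_ob K x" "Cod E g = on_ob K y"
    using g by (simp_all add: E.Hom_iff)
  note [simp] = x
  define k where "k = Cmp C (Inv C (s y)) (Cmp C (on_ar G g) (s x))"
  have k [simp]: "k \<in> Ar C" "Dom C k = x" "Cod C k = y" by (simp_all add: k_def)
  have "Cmp C (on_ar G (on_ar K k)) (s x) = Cmp C (s y) k"
    using nat_trans_simps(4)[OF C C nt k(1)] by (simp add: id_func_def comp_func_def)
  also have "\<dots> = Cmp C (on_ar G g) (s x)" by (simp add: k_def)
  finally have "on_ar G (on_ar K k) = on_ar G g"
    by (rule C.iso_cancel_right[rotated -1]) simp_all
  then have "on_ar K k = g"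
    by (rule faithful_if_retract[OF E C G K
          nat_iso_inverse[OF E E is_functor_comp[OF E C E G K] E.is_functor_id t], rotated -1]) simp_all
  then show ?thesis using k by (auto simp: C.Hom_iff)
qed

lemma equivalence_essentially_surjective:
  assumes C: "category C" and E: "category E" and eqv: "is_equivalence C E K" and z: "z \<in> Ob E"
  shows "\<exists>x \<in> Ob C. \<exists>g \<in> Hom E (on_ob K x) z. is_isomorphism E g"
proof -
  obtain G t where G: "is_functor E C G" and t: "is_nat_iso E E (comp_func K G) id_func t"
    using eqv by (auto simp: is_equivalence_def)
  have "on_ob G z \<in> Ob C" using G z by (simp add: is_functor_def)
  moreover have "t z \<in> Hom E (on_ob K (on_ob G z)) z" "is_isomorphism E (t z)"
    using t z by (auto simp: is_nat_iso_def is_nat_trans_def id_func_def comp_func_def)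
  ultimately show ?thesis by blast
qed

section \<open>Comonadic adjunctions\<close>

locale adjoint_functors = C: category C + D: category D
  for C :: "('o, 'm) cat" and D :: "('p, 'n) cat" +
  fixes F :: "('o, 'm, 'p, 'n) func" and U :: "('p, 'n, 'o, 'm) func"
    and \<eta> :: "'o \<Rightarrow> 'm" and \<epsilon> :: "'p \<Rightarrow> 'n"
  assumes adj: "is_adjunction C D F U \<eta> \<epsilon>"
begin

abbreviation "coalg \<equiv> is_coalgebra D (comp_func F U) \<epsilon> (\<lambda>y. on_ar F (\<eta> (on_ob U y)))"
abbreviation "Coalg \<equiv> coalgebra_cat D (comp_func F U) \<epsilon> (\<lambda>y. on_ar F (\<eta> (on_ob U y)))"

lemma F: "is_functor C D F" and U: "is_functor D C U"
  using adj by (simp_all add: is_adjunction_def)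

lemmas F_simps [simp] = functor_simps[OF C.category_axioms D.category_axioms F]
lemmas U_simps [simp] = functor_simps[OF D.category_axioms C.category_axioms U]
lemmas F_iso [simp] = functor_iso[OF C.category_axioms D.category_axioms F]
lemmas U_iso [simp] = functor_iso[OF D.category_axioms C.category_axioms U]

lemma unit_arr [simp]:
  assumes "x \<in> Ob C"
  shows "\<eta> x \<in> Ar C" "Dom C (\<eta> x) = x" "Cod C (\<eta> x) = on_ob U (on_ob F x)"
  using adj assms by (auto simp: is_adjunction_def is_nat_trans_def id_func_def comp_func_def C.Hom_iff)

lemma counit_arr [simp]:
  assumes "y \<in> Ob D"
  shows "\<epsilon> y \<in> Ar D" "Dom D (\<epsilon> y) = on_ob F (on_ob U y)" "Cod D (\<epsilon> y) = y"
  using adj assms by (auto simp: is_adjunction_def is_nat_trans_def id_func_def comp_func_def D.Hom_iff)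

lemma unit_nat:
  assumes "k \<in> Ar C" "y = Cod C k"
  shows "Cmp C (\<eta> y) k = Cmp C (on_ar U (on_ar F k)) (\<eta> (Dom C k))"
  using adj assms by (auto simp: is_adjunction_def is_nat_trans_def id_func_def comp_func_def C.Hom_iff)

lemma counit_nat:
  assumes "k \<in> Ar D" "y = Cod D k"
  shows "Cmp D (\<epsilon> y) (on_ar F (on_ar U k)) = Cmp D k (\<epsilon> (Dom D k))"
  using adj assms by (auto simp: is_adjunction_def is_nat_trans_def id_func_def comp_func_def D.Hom_iff)

lemma zigzag_F [simp]: "x \<in> Ob C \<Longrightarrow> Cmp D (\<epsilon> (on_ob F x)) (on_ar F (\<eta> x)) = Id D (on_ob F x)"
  and zigzag_U [simp]: "y \<in> Ob D \<Longrightarrow> Cmp C (on_ar U (\<epsilon> y)) (\<eta> (on_ob U y)) = Id C (on_ob U y)"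
  using adj by (auto simp: is_adjunction_def)

text \<open>The arrow \<open>F x \<rightarrow> y\<close> corresponding to \<open>i : x \<rightarrow> U y\<close> under the adjunction.\<close>

definition transpose :: "'p \<Rightarrow> 'm \<Rightarrow> 'n" where
  "transpose y i = Cmp D (\<epsilon> y) (on_ar F i)"

lemma transpose_arr [simp]:
  assumes "y \<in> Ob D" "i \<in> Ar C" "Cod C i = on_ob U y"
  shows "transpose y i \<in> Ar D" "Dom D (transpose y i) = on_ob F (Dom C i)" "Cod D (transpose y i) = y"
  using assms by (simp_all add: transpose_def)

lemma untranspose:
  assumes [simp]: "y \<in> Ob D" "i \<in> Ar C" "Cod C i = on_ob U y"
  shows "Cmp C (on_ar U (transpose y i)) (\<eta> (Dom C i)) = i"
proof -
  have "Cmp C (on_ar U (transpose y i)) (\<eta> (Dom C i)) =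
      Cmp C (on_ar U (\<epsilon> y)) (Cmp C (\<eta> (on_ob U y)) i)"
    by (simp add: transpose_def C.assoc unit_nat)
  also have "\<dots> = i" by (simp add: C.Cmp_extend[OF zigzag_U])
  finally show ?thesis .
qed

lemma transpose_untranspose:
  assumes [simp]: "x \<in> Ob C" "k \<in> Ar D" "Dom D k = on_ob F x" "Cod D k = y"
  shows "transpose y (Cmp C (on_ar U k) (\<eta> x)) = k"
proof -
  have [simp]: "y \<in> Ob D" using D.Cod_Ob[of k] by simp
  have "transpose y (Cmp C (on_ar U k) (\<eta> x)) = Cmp D k (Cmp D (\<epsilon> (on_ob F x)) (on_ar F (\<eta> x)))"
    by (simp add: transpose_def counit_nat[THEN D.Cmp_extend2])
  then show ?thesis by simp
qed

text \<open>The transposes of \<open>k\<close> and \<open>l\<close> are \<open>U k \<cdot> \<eta> x\<close> and \<open>U l \<cdot> \<eta> x\<close>, which agree.\<close>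

lemma U_reflects_eq:
  assumes "x \<in> Ob C" "k \<in> Ar D" "l \<in> Ar D" "Dom D k = on_ob F x" "Dom D l = on_ob F x"
    "Cod D k = Cod D l" "on_ar U k = on_ar U l"
  shows "k = l"
proof -
  have "transpose (Cod D k) (Cmp C (on_ar U k) (\<eta> x)) = k"
    "transpose (Cod D l) (Cmp C (on_ar U l) (\<eta> x)) = l"
    by (rule transpose_untranspose; use assms in simp)+
  then show ?thesis using assms(6,7) by (metis (no_types))
qed

text \<open>A section \<open>s\<close> of the counit at \<open>y\<close> makes \<open>k\<close> a split epimorphism, by naturality of the counit and
  since \<open>F (U k)\<close> is invertible. The section so obtained is also a left inverse, because it is so
  after applying \<open>U\<close>, and \<open>U\<close> distinguishes endomorphisms of \<open>F x\<close>.\<close>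

lemma U_reflects_iso:
  assumes [simp]: "y \<in> Ob D" "s \<in> Ar D" "Dom D s = y" "Cod D s = on_ob F (on_ob U y)"
    and split: "Cmp D (\<epsilon> y) s = Id D y"
    and [simp]: "x \<in> Ob C" "k \<in> Ar D" "Dom D k = on_ob F x" "Cod D k = y"
    and iso: "is_isomorphism C (on_ar U k)"
  shows "is_isomorphism D k"
proof -
  note [simp] = iso
  define r where "r = Cmp D (\<epsilon> (on_ob F x)) (Cmp D (on_ar F (Inv C (on_ar U k))) s)"
  have r [simp]: "r \<in> Ar D" "Dom D r = y" "Cod D r = on_ob F x" by (simp_all add: r_def)
  have kr: "Cmp D k r = Id D y"
  proof -
    have "Cmp D k r = Cmp D (\<epsilon> y) (Cmp D (Cmp D (on_ar F (on_ar U k)) (on_ar F (Inv C (on_ar U k)))) s)"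
      by (simp add: r_def D.assoc counit_nat[of k y, THEN D.Cmp_extend2])
    also have "Cmp D (on_ar F (on_ar U k)) (on_ar F (Inv C (on_ar U k))) = Id D (on_ob F (on_ob U y))"
      by (simp flip: F_simps(6))
    finally show ?thesis by (simp add: split)
  qed
  have "Cmp C (on_ar U k) (on_ar U r) = Id C (on_ob U y)"
    by (simp add: kr flip: U_simps(6))
  then have Ur: "on_ar U r = Inv C (on_ar U k)"
    using C.Inv_move_left[OF iso, of "on_ar U r"] by simp
  have rk: "Cmp D r k = Id D (on_ob F x)"
    by (rule U_reflects_eq[of x]) (simp_all add: Ur)
  show ?thesis by (rule D.isoI(1)[where l = r]) (simp_all add: kr rk)
qed

text \<open>If the transpose \<open>k\<close> of \<open>i\<close> is invertible, the cofree coalgebra on its domain is transported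
  along \<open>k\<close> to \<open>y\<close>. By \<open>untranspose\<close>, \<open>F i = F (U k) \<cdot> F (\<eta> x)\<close>, so \<open>F i \<cdot> k\<inverse>\<close> is the
  resulting structure.\<close>

definition coaction :: "'p \<Rightarrow> 'm \<Rightarrow> 'n" where
  "coaction y i = Cmp D (on_ar F i) (Inv D (transpose y i))"

definition transpose_invertible :: "'p \<Rightarrow> 'm \<Rightarrow> bool" where
  "transpose_invertible y i \<longleftrightarrow> i \<in> Ar C \<and> Cod C i = on_ob U y \<and> is_isomorphism D (transpose y i)"

lemma transpose_invertible_simps:
  assumes "transpose_invertible y i"
  shows "i \<in> Ar C" "Cod C i = on_ob U y" "is_isomorphism D (transpose y i)"
  using assms by (simp_all add: transpose_invertible_def)

lemma coaction_arr:
  assumes "y \<in> Ob D" "transpose_invertible y i"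
  shows "coaction y i \<in> Ar D" "Dom D (coaction y i) = y" "Cod D (coaction y i) = on_ob F (on_ob U y)"
  using assms transpose_invertible_simps[OF assms(2)] by (simp_all add: coaction_def)

lemma coaction_transpose:
  assumes "y \<in> Ob D" "transpose_invertible y i"
  shows "Cmp D (coaction y i) (transpose y i) = on_ar F i"
  using assms transpose_invertible_simps[OF assms(2)] by (simp add: coaction_def D.assoc)

lemma counit_coaction:
  assumes "y \<in> Ob D" "transpose_invertible y i"
  shows "Cmp D (\<epsilon> y) (coaction y i) = Id D y"
proof -
  note [simp] = assms transpose_invertible_simps[OF assms(2)]
  have "Cmp D (\<epsilon> y) (coaction y i) = Cmp D (transpose y i) (Inv D (transpose y i))"
    by (subst (1) transpose_def) (simp add: coaction_def D.assoc)
  then show ?thesis by simp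
qed

lemma coalgebra_coaction:
  assumes "y \<in> Ob D" "transpose_invertible y i"
  shows "coalg (y, coaction y i)"
proof -
  note [simp] = assms transpose_invertible_simps[OF assms(2)]
  let ?k = "transpose y i"
  have u: "Cmp C (on_ar U (Inv D ?k)) i = \<eta> (Dom C i)"
    using C.Inv_move_left[of "on_ar U ?k" "\<eta> (Dom C i)", OF _ _ _ untranspose] by simp
  have "Cmp D (on_ar F (\<eta> (on_ob U y))) (coaction y i) =
      Cmp D (on_ar F (on_ar U (on_ar F i))) (Cmp D (on_ar F (\<eta> (Dom C i))) (Inv D ?k))"
    by (simp add: coaction_def unit_nat[of i] flip: D.assoc F_simps(6))
  also have "on_ar F (\<eta> (Dom C i)) = Cmp D (on_ar F (on_ar U (Inv D ?k))) (on_ar F i)"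
    by (simp add: u flip: F_simps(6))
  finally have "Cmp D (on_ar F (\<eta> (on_ob U y))) (coaction y i) =
      Cmp D (on_ar F (on_ar U (coaction y i))) (coaction y i)"
    by (simp add: coaction_def D.assoc)
  then show ?thesis
    using counit_coaction[OF assms]
    by (simp add: is_coalgebra_def comp_func_def D.Hom_iff coaction_arr)
qed

lemma coaction_precompose_iso:
  assumes y: "y \<in> Ob D" and j: "transpose_invertible y j" and u: "is_isomorphism C u" "Cod C u = Dom C j"
  shows "transpose_invertible y (Cmp C j u)" "coaction y (Cmp C j u) = coaction y j"
proof -
  note [simp] = y j u transpose_invertible_simps[OF j] C.iso_arr[OF u(1)]
  have t: "transpose y (Cmp C j u) = Cmp D (transpose y j) (on_ar F u)"
    by (simp add: transpose_def D.assoc)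
  show "transpose_invertible y (Cmp C j u)"
    by (simp add: transpose_invertible_def t D.iso_Cmp(1))
  have "Cmp D (on_ar F u) (on_ar F (Inv C u)) = Id D (on_ob F (Cod C u))"
    by (simp flip: F_simps(6))
  then show "coaction y (Cmp C j u) = coaction y j"
    by (simp add: coaction_def t D.iso_Cmp(2) D.assoc D.Cmp_extend)
qed

lemma coalg_iff:
  "coalg X \<longleftrightarrow> (fst X \<in> Ob D \<and> snd X \<in> Ar D \<and> Dom D (snd X) = fst X \<and>
     Cod D (snd X) = on_ob F (on_ob U (fst X)) \<and> Cmp D (\<epsilon> (fst X)) (snd X) = Id D (fst X) \<and>
     Cmp D (on_ar F (\<eta> (on_ob U (fst X)))) (snd X) = Cmp D (on_ar F (on_ar U (snd X))) (snd X))"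
  by (cases X) (auto simp: is_coalgebra_def comp_func_def D.Hom_iff)

lemma Coalg_Hom_iff:
  "K \<in> Hom Coalg X Y \<longleftrightarrow> (\<exists>k. K = (X, Y, k) \<and> coalg X \<and> coalg Y \<and> k \<in> Ar D \<and>
     Dom D k = fst X \<and> Cod D k = fst Y \<and>
     Cmp D (snd Y) k = Cmp D (on_ar F (on_ar U k)) (snd X))"
  by (cases K) (auto simp: Hom_def coalgebra_cat_def comp_func_def)

lemma Coalg_simps [simp]:
  "Ob Coalg = {X. coalg X}" "Dom Coalg (X, Y, k) = X" "Cod Coalg (X, Y, k) = Y"
  "Id Coalg X = (X, X, Id D (fst X))" "Cmp Coalg (Y', Z, l) (X, Y, k) = (X, Z, Cmp D l k)"
  by (simp_all add: coalgebra_cat_def)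

lemma Coalg_Ar_iff: "K \<in> Ar Coalg \<longleftrightarrow> (\<exists>X Y. K \<in> Hom Coalg X Y)"
  by (auto simp: Hom_def)

lemma category_Coalg: "category Coalg"
proof
  fix K assume "K \<in> Ar Coalg"
  then show "Dom Coalg K \<in> Ob Coalg" "Cod Coalg K \<in> Ob Coalg"
    by (auto simp: Coalg_Ar_iff Coalg_Hom_iff)
next
  fix X assume "X \<in> Ob Coalg"
  then show "Id Coalg X \<in> Hom Coalg X X"
    by (auto simp: Coalg_Hom_iff coalg_iff)
next
  fix K L X Y Z assume "K \<in> Hom Coalg X Y" "L \<in> Hom Coalg Y Z"
  then obtain k l where kl: "K = (X, Y, k)" "L = (Y, Z, l)" "coalg X" "coalg Y" "coalg Z"
    "k \<in> Ar D" "Dom D k = fst X" "Cod D k = fst Y" "l \<in> Ar D" "Dom D l = fst Y" "Cod D l = fst Z"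
    "Cmp D (snd Y) k = Cmp D (on_ar F (on_ar U k)) (snd X)"
    "Cmp D (snd Z) l = Cmp D (on_ar F (on_ar U l)) (snd Y)"
    by (auto simp: Coalg_Hom_iff)
  note [simp] = kl(6-11)
  have [simp]: "snd X \<in> Ar D" "Dom D (snd X) = fst X" "Cod D (snd X) = on_ob F (on_ob U (fst X))"
    "snd Y \<in> Ar D" "Dom D (snd Y) = fst Y" "Cod D (snd Y) = on_ob F (on_ob U (fst Y))"
    "snd Z \<in> Ar D" "Dom D (snd Z) = fst Z" "Cod D (snd Z) = on_ob F (on_ob U (fst Z))"
    using kl(3-5) by (auto simp: coalg_iff)
  have "Cmp D (snd Z) (Cmp D l k) = Cmp D (on_ar F (on_ar U (Cmp D l k))) (snd X)"
    by (simp add: D.Cmp_extend2[OF kl(13)] kl(12) D.assoc)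
  then show "Cmp Coalg L K \<in> Hom Coalg X Z"
    using kl(3-5) by (auto simp: kl(1,2) Coalg_Hom_iff)
next
  fix K X Y assume "K \<in> Hom Coalg X Y"
  then show "Cmp Coalg (Id Coalg Y) K = K" "Cmp Coalg K (Id Coalg X) = K"
    by (auto simp: Coalg_Hom_iff)
next
  fix K W X L Y M Z assume "K \<in> Hom Coalg W X" "L \<in> Hom Coalg X Y" "M \<in> Hom Coalg Y Z"
  then show "Cmp Coalg (Cmp Coalg M L) K = Cmp Coalg M (Cmp Coalg L K)"
    by (auto simp: Coalg_Hom_iff D.assoc)
qed

end

locale comonadic_adjunction = adjoint_functors +
  assumes eqv: "is_equivalence C Coalg (comparison_func C F \<eta>)"
begin

abbreviation "K \<equiv> comparison_func C F \<eta>"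

lemma K_simps [simp]:
  "on_ob K x = (on_ob F x, on_ar F (\<eta> x))"
  "on_ar K k = (on_ob K (Dom C k), on_ob K (Cod C k), on_ar F k)"
  by (simp_all add: comparison_func_def)

lemma F_faithful:
  assumes "k \<in> Ar C" "l \<in> Ar C" "Dom C k = Dom C l" "Cod C k = Cod C l" "on_ar F k = on_ar F l"
  shows "k = l"
  by (rule equivalence_faithful[OF C.category_axioms category_Coalg eqv assms(1-4)]) (simp add: assms(3-5))

lemma coalg_K:
  assumes [simp]: "x \<in> Ob C"
  shows "coalg (on_ob K x)"
  using functor_simps(1)[OF C.category_axioms category_Coalg, of K x] eqv
  by (auto simp: is_equivalence_def)

text \<open>Fullness of the comparison functor, with the definition of its codomain unfolded.\<close>

lemma K_full:
  assumes x: "x \<in> Ob C" "y \<in> Ob C"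
    and g: "g \<in> Ar D" "Dom D g = on_ob F x" "Cod D g = on_ob F y"
    and "Cmp D (on_ar F (\<eta> y)) g = Cmp D (on_ar F (on_ar U g)) (on_ar F (\<eta> x))"
  shows "\<exists>k \<in> Ar C. Dom C k = x \<and> Cod C k = y \<and> on_ar F k = g"
proof -
  have "(on_ob K x, on_ob K y, g) \<in> Hom Coalg (on_ob K x) (on_ob K y)"
    using assms coalg_K by (auto simp: Coalg_Hom_iff)
  from equivalence_full[OF C.category_axioms category_Coalg eqv x this]
  show ?thesis by (auto simp: C.Hom_iff)
qed

text \<open>By essential surjectivity \<open>(y, s)\<close> is isomorphic to a cofree coalgebra \<open>F x\<close>, say by \<open>g\<close>; the arrow
  with transpose \<open>g\<close> then has coaction \<open>s\<close>.\<close>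

lemma coalgebra_is_coaction:
  assumes s: "coalg (y, s)"
  shows "\<exists>i. transpose_invertible y i \<and> coaction y i = s"
proof -
  have [simp]: "y \<in> Ob D" "s \<in> Ar D" "Dom D s = y" "Cod D s = on_ob F (on_ob U y)"
    using s by (simp_all add: coalg_iff)
  obtain x G where [simp]: "x \<in> Ob C" and G: "G \<in> Hom Coalg (on_ob K x) (y, s)" "is_isomorphism Coalg G"
    using equivalence_essentially_surjective[OF C.category_axioms category_Coalg eqv, of "(y, s)"] s by auto
  then obtain g where g: "G = (on_ob K x, (y, s), g)" and [simp]: "g \<in> Ar D" "Dom D g = on_ob F x" "Cod D g = y"
    and eq: "Cmp D s g = Cmp D (on_ar F (on_ar U g)) (on_ar F (\<eta> x))"
    by (auto simp: Coalg_Hom_iff)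
  obtain H where "inverse_arrows Coalg G H" using G(2) by (auto simp: is_isomorphism_def)
  then obtain h where "h \<in> Ar D" "Dom D h = y" "Cod D h = on_ob F x"
    "Cmp D h g = Id D (on_ob F x)" "Cmp D g h = Id D y"
    by (auto simp: inverse_arrows_def g Coalg_Hom_iff)
  then have iso: "is_isomorphism D g" by (auto intro: D.isoI(1))
  let ?i = "Cmp C (on_ar U g) (\<eta> x)"
  have t: "transpose y ?i = g" by (rule transpose_untranspose) simp_all
  have "coaction y ?i = Cmp D (Cmp D s g) (Inv D g)"
    using eq by (simp add: coaction_def t iso)
  also have "\<dots> = s" by (simp add: D.assoc iso)
  finally show ?thesis
    by (intro exI[of _ ?i]) (simp add: transpose_invertible_def t iso)
qed

text \<open>The isomorphism \<open>(transpose y j)\<inverse> \<cdot> transpose y i\<close> is a morphism of cofree coalgebras,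
  hence in the image of the comparison functor.\<close>

lemma coaction_eq_lift:
  assumes y: "y \<in> Ob D" and i: "transpose_invertible y i" and j: "transpose_invertible y j"
    and eq: "coaction y i = coaction y j"
  shows "\<exists>u \<in> Ar C. Dom C u = Dom C i \<and> Cod C u = Dom C j \<and> Cmp C j u = i \<and>
    on_ar F u = Cmp D (Inv D (transpose y j)) (transpose y i)"
proof -
  note [simp] = y transpose_invertible_simps[OF i] transpose_invertible_simps[OF j]
  let ?g = "Cmp D (Inv D (transpose y j)) (transpose y i)"
  have Fj: "Cmp D (on_ar F j) ?g = on_ar F i"
    using coaction_transpose[OF y i] unfolding eq by (simp add: coaction_def D.assoc)
  have un: "on_ar F k = Cmp D (on_ar F (on_ar U (transpose y k))) (on_ar F (\<eta> (Dom C k)))"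
    if "transpose_invertible y k" for k
    using untranspose[OF y] transpose_invertible_simps[OF that]
    by (simp flip: F_simps(6))
  have g: "Cmp D (on_ar F (on_ar U (transpose y j))) (on_ar F (on_ar U ?g)) =
      on_ar F (on_ar U (transpose y i))"
    by (simp flip: F_simps(6) U_simps(6))
  have "Cmp D (on_ar F (\<eta> (Dom C j))) ?g = Cmp D (on_ar F (on_ar U ?g)) (on_ar F (\<eta> (Dom C i)))"
  proof (rule D.iso_cancel_left[where k = "on_ar F (on_ar U (transpose y j))"])
    have "Cmp D (on_ar F (on_ar U (transpose y j))) (Cmp D (on_ar F (\<eta> (Dom C j))) ?g) = on_ar F i"
      by (subst D.Cmp_extend[OF un[OF j, symmetric]]) (simp_all add: Fj)
    also have "\<dots> = Cmp D (on_ar F (on_ar U (transpose y j)))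
        (Cmp D (on_ar F (on_ar U ?g)) (on_ar F (\<eta> (Dom C i))))"
      unfolding un[OF i] by (subst D.Cmp_extend[OF g]) simp_all
    finally show "Cmp D (on_ar F (on_ar U (transpose y j))) (Cmp D (on_ar F (\<eta> (Dom C j))) ?g) =
      Cmp D (on_ar F (on_ar U (transpose y j)))
        (Cmp D (on_ar F (on_ar U ?g)) (on_ar F (\<eta> (Dom C i))))" .
  qed simp_all
  then obtain u where u: "u \<in> Ar C" "Dom C u = Dom C i" "Cod C u = Dom C j" "on_ar F u = ?g"
    using K_full[of "Dom C i" "Dom C j" ?g] by auto
  moreover have "Cmp C j u = i"
    by (rule F_faithful) (simp_all add: u Fj)
  ultimately show ?thesis by blast
qed

lemma coaction_eq_iso:
  assumes y: "y \<in> Ob D" and i: "transpose_invertible y i" and j: "transpose_invertible y j"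
    and eq: "coaction y i = coaction y j"
  shows "\<exists>u. is_isomorphism C u \<and> Dom C u = Dom C i \<and> Cod C u = Dom C j \<and> Cmp C j u = i"
proof -
  note [simp] = y transpose_invertible_simps[OF i] transpose_invertible_simps[OF j]
  obtain u where u [simp]: "u \<in> Ar C" "Dom C u = Dom C i" "Cod C u = Dom C j" "Cmp C j u = i"
    "on_ar F u = Cmp D (Inv D (transpose y j)) (transpose y i)"
    using coaction_eq_lift[OF y i j eq] by blast
  obtain v where v [simp]: "v \<in> Ar C" "Dom C v = Dom C j" "Cod C v = Dom C i"
    "on_ar F v = Cmp D (Inv D (transpose y i)) (transpose y j)"
    using coaction_eq_lift[OF y j i eq[symmetric]] by blast
  have "Cmp C v u = Id C (Dom C i)" "Cmp C u v = Id C (Dom C j)"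
    by (rule F_faithful; simp add: D.assoc)+
  then have "is_isomorphism C u" by (auto intro: C.isoI(1)[where l = v])
  then show ?thesis using u by blast
qed

text \<open>\<open>F i\<close> is monic because the coaction is a section of the counit, and \<open>F\<close> is faithful.\<close>

lemma transpose_invertible_mono:
  assumes y: "y \<in> Ob D" and i: "transpose_invertible y i"
  shows "is_mono C i"
proof -
  note [simp] = y transpose_invertible_simps[OF i]
  have "k = l" if kl: "k \<in> Hom C w (Dom C i)" "l \<in> Hom C w (Dom C i)" "Cmp C i k = Cmp C i l" for w k l
  proof -
    have [simp]: "k \<in> Ar C" "l \<in> Ar C" "Dom C k = w" "Dom C l = w" "Cod C k = Dom C i" "Cod C l = Dom C i"
      using kl by (simp_all add: C.Hom_iff)
    have "Cmp D (transpose y i) (on_ar F m) = Cmp D (\<epsilon> y) (on_ar F (Cmp C i m))"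
      if [simp]: "m \<in> Ar C" "Cod C m = Dom C i" for m
      by (simp add: transpose_def D.assoc)
    then have "Cmp D (transpose y i) (on_ar F k) = Cmp D (transpose y i) (on_ar F l)"
      by (simp add: kl(3) del: F_simps(6))
    then have "on_ar F k = on_ar F l"
      by (rule D.iso_cancel_left[rotated -1]) simp_all
    then show "k = l" by (rule F_faithful[rotated -1]) simp_all
  qed
  then show ?thesis by (auto simp: is_mono_def)
qed

end

section \<open>Coherence for an adjunction in a bicategory\<close>

locale internal_adjunction = bicategory B for B :: "('o, 'a, 'c) bicat" (structure) +
  fixes a b :: 'o and f f' :: 'a and \<eta> \<epsilon> :: 'c
  assumes adjunction: "adjunction_in B a b f f' \<eta> \<epsilon>"
begin

lemma f_simps [simp]:
  "ob f" "Src B f = a" "Trg B f = b" "ob f'" "Src B f' = b" "Trg B f' = a" "a \<in> Cells B" "b \<in> Cells B"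
  using adjunction Src_Cells[of f] Trg_Cells[of f] by (auto simp: adjunction_in_def cells1_def)

lemma unit_counit_simps [simp]:
  "ar \<eta>" "dom\<^sub>2 \<eta> = Unit B a" "cod\<^sub>2 \<eta> = f' \<star> f"
  "ar \<epsilon>" "dom\<^sub>2 \<epsilon> = f \<star> f'" "cod\<^sub>2 \<epsilon> = Unit B b"
  using adjunction by (auto simp: adjunction_in_def V.Hom_iff)

text \<open>\<open>punit\<close> and \<open>pcounit\<close> are the unit and counit of the adjunction between \<open>f \<star> -\<close> and \<open>f' \<star> -\<close>.\<close>

abbreviation "S \<equiv> f' \<star> f"
abbreviation "K \<equiv> f \<star> f'"
abbreviation "punit \<equiv> post_unit B f f' \<eta>"
abbreviation "pcounit \<equiv> post_counit B f f' \<epsilon>"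
abbreviation "m \<equiv> adj_mult B f f' \<epsilon>"
abbreviation "\<delta> \<equiv> adj_comult B f f' \<eta>"

text \<open>The 2-cells from which everything below is composed. \<open>counit_f\<close> is \<open>pcounit f\<close> and makes \<open>f\<close> a right
  module over \<open>S\<close>; \<open>\<mu>\<close> makes \<open>f'\<close> a left module. \<open>\<Theta>\<close> is the part of the 2-cell \<open>adj_theta\<close> that does not
  depend on \<open>i\<close>. \<open>preunit_f\<close> and \<open>precounit\<close> are the unit (at \<open>f\<close>) and the counit of the adjunction
  in which precomposition with \<open>f'\<close> is left adjoint to precomposition with \<open>f\<close>.\<close>

definition "counit_f = \<l> f \<cdot> (\<epsilon> \<diamondop> \<iota> f) \<cdot> vinv (\<a> f f' f)"
definition "\<mu> = \<r> f' \<cdot> (\<iota> f' \<diamondop> \<epsilon>) \<cdot> \<a> f' f f'"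
definition "\<Theta> = (\<iota> f \<diamondop> \<mu>) \<cdot> \<a> f S f'"
definition "preunit_f = vinv (\<a> f f' f) \<cdot> (\<iota> f \<diamondop> \<eta>) \<cdot> vinv (\<r> f)"
definition "precounit y = \<r> y \<cdot> (\<iota> y \<diamondop> \<epsilon>) \<cdot> \<a> y f f'"

lemma punit_ar [simp]:
  assumes "ob y" "Trg B y = a"
  shows "ar (punit y)" "dom\<^sub>2 (punit y) = y" "cod\<^sub>2 (punit y) = f' \<star> (f \<star> y)"
  using assms by (simp_all add: post_unit_def)

lemma pcounit_ar [simp]:
  assumes "ob y" "Trg B y = b"
  shows "ar (pcounit y)" "dom\<^sub>2 (pcounit y) = f \<star> (f' \<star> y)" "cod\<^sub>2 (pcounit y) = y"
  using assms by (simp_all add: post_counit_def)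

lemma precounit_ar [simp]:
  assumes "ob y" "Src B y = b"
  shows "ar (precounit y)" "dom\<^sub>2 (precounit y) = (y \<star> f) \<star> f'" "cod\<^sub>2 (precounit y) = y"
  using assms by (simp_all add: precounit_def)

lemma two_cells [simp]:
  "ar counit_f" "dom\<^sub>2 counit_f = f \<star> S" "cod\<^sub>2 counit_f = f"
  "ar \<mu>" "dom\<^sub>2 \<mu> = S \<star> f'" "cod\<^sub>2 \<mu> = f'"
  "ar \<Theta>" "dom\<^sub>2 \<Theta> = (f \<star> S) \<star> f'" "cod\<^sub>2 \<Theta> = K"
  "ar preunit_f" "dom\<^sub>2 preunit_f = f" "cod\<^sub>2 preunit_f = K \<star> f"
  "ar m" "dom\<^sub>2 m = S \<star> S" "cod\<^sub>2 m = S"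
  "ar \<delta>" "dom\<^sub>2 \<delta> = K" "cod\<^sub>2 \<delta> = K \<star> K"
  by (simp_all add: counit_f_def \<mu>_def \<Theta>_def preunit_f_def adj_mult_def adj_comult_def)

lemma pcounit_f: "pcounit f = counit_f"
  by (simp add: post_counit_def counit_f_def)

lemma m_eq: "m = (\<iota> f' \<diamondop> counit_f) \<cdot> \<a> f' f S"
  by (simp add: adj_mult_def counit_f_def whisker_left V.assoc)

lemma \<delta>_eq: "\<a> f f' K \<cdot> \<delta> = \<iota> f \<diamondop> punit f'"
  by (simp add: adj_comult_def post_unit_def whisker_left V.assoc)

lemma counit_f_unit: "counit_f \<cdot> (\<iota> f \<diamondop> \<eta>) = \<r> f"
proof -
  have "(counit_f \<cdot> (\<iota> f \<diamondop> \<eta>)) \<cdot> vinv (\<r> f) = \<r> f \<cdot> vinv (\<r> f)"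
    using adjunction by (simp add: adjunction_in_def counit_f_def V.assoc)
  then show ?thesis by (rule V.iso_cancel_right[rotated -1]) simp_all
qed

lemma \<mu>_unit: "\<mu> \<cdot> (\<eta> \<diamondop> \<iota> f') = \<l> f'"
proof -
  have "(\<mu> \<cdot> (\<eta> \<diamondop> \<iota> f')) \<cdot> vinv (\<l> f') = \<l> f' \<cdot> vinv (\<l> f')"
    using adjunction by (simp add: adjunction_in_def \<mu>_def V.assoc)
  then show ?thesis by (rule V.iso_cancel_right[rotated -1]) simp_all
qed

lemma assoc_preunit_f: "\<a> f f' f \<cdot> preunit_f = (\<iota> f \<diamondop> \<eta>) \<cdot> vinv (\<r> f)"
  by (simp add: preunit_f_def)

lemma pcounit_assoc:
  assumes "ob y" "Trg B y = b"
  shows "pcounit y \<cdot> \<a> f f' y = \<l> y \<cdot> (\<epsilon> \<diamondop> \<iota> y)"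
  using assms by (simp add: post_counit_def V.assoc)

lemma pcounit_natural:
  assumes "ar \<sigma>" "Trg B (dom\<^sub>2 \<sigma>) = b" "y = cod\<^sub>2 \<sigma>"
  shows "pcounit y \<cdot> (\<iota> f \<diamondop> (\<iota> f' \<diamondop> \<sigma>)) = \<sigma> \<cdot> pcounit (dom\<^sub>2 \<sigma>)"
proof (rule V.iso_cancel_right[where k = "\<a> f f' (dom\<^sub>2 \<sigma>)"])
  note [simp] = assms
  have "(pcounit y \<cdot> (\<iota> f \<diamondop> (\<iota> f' \<diamondop> \<sigma>))) \<cdot> \<a> f f' (dom\<^sub>2 \<sigma>) = pcounit y \<cdot> \<a> f f' y \<cdot> (\<iota> K \<diamondop> \<sigma>)"
    by (simp add: V.assoc Assoc_nat_right[where h = f and g = f'])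
  also have "\<dots> = \<l> y \<cdot> (\<epsilon> \<diamondop> \<iota> y) \<cdot> (\<iota> K \<diamondop> \<sigma>)"
    by (simp add: pcounit_assoc V.assoc V.Cmp_extend[OF pcounit_assoc])
  also have "\<dots> = \<l> y \<cdot> (\<iota> (Unit B b) \<diamondop> \<sigma>) \<cdot> (\<epsilon> \<diamondop> \<iota> (dom\<^sub>2 \<sigma>))"
    by (simp add: slide)
  also have "\<dots> = \<sigma> \<cdot> \<l> (dom\<^sub>2 \<sigma>) \<cdot> (\<epsilon> \<diamondop> \<iota> (dom\<^sub>2 \<sigma>))"
    by (simp add: Lunit_nat[THEN V.Cmp_extend2])
  also have "\<dots> = (\<sigma> \<cdot> pcounit (dom\<^sub>2 \<sigma>)) \<cdot> \<a> f f' (dom\<^sub>2 \<sigma>)"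
    by (simp add: pcounit_assoc V.assoc)
  finally show "(pcounit y \<cdot> (\<iota> f \<diamondop> (\<iota> f' \<diamondop> \<sigma>))) \<cdot> \<a> f f' (dom\<^sub>2 \<sigma>) = (\<sigma> \<cdot> pcounit (dom\<^sub>2 \<sigma>)) \<cdot> \<a> f f' (dom\<^sub>2 \<sigma>)" .
qed (use assms in simp_all)

text \<open>The counit of the adjunction between \<open>f \<star> -\<close> and \<open>f' \<star> -\<close> is compatible with
  precomposition: both sides agree after composing with \<open>\<a> f f' y \<diamondop> g\<close>, by the pentagon and \<open>Lunit_HC1\<close>.\<close>

lemma pcounit_HC1:
  assumes [simp]: "ob y" "ob g" "Trg B y = b" "Src B y = Trg B g"
  shows "pcounit (y \<star> g) \<cdot> (\<iota> f \<diamondop> \<a> f' y g) \<cdot> \<a> f (f' \<star> y) g = pcounit y \<diamondop> \<iota> g"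
proof (rule V.iso_cancel_right[where k = "\<a> f f' y \<diamondop> \<iota> g"])
  have "(pcounit (y \<star> g) \<cdot> (\<iota> f \<diamondop> \<a> f' y g) \<cdot> \<a> f (f' \<star> y) g) \<cdot> (\<a> f f' y \<diamondop> \<iota> g) =
      pcounit (y \<star> g) \<cdot> \<a> f f' (y \<star> g) \<cdot> \<a> K y g"
    by (simp add: V.assoc pentagon_eq)
  also have "\<dots> = \<l> (y \<star> g) \<cdot> (\<epsilon> \<diamondop> \<iota> (y \<star> g)) \<cdot> \<a> K y g"
    by (simp add: V.Cmp_extend[OF pcounit_assoc] V.assoc)
  also have "\<dots> = \<l> (y \<star> g) \<cdot> \<a> (Unit B b) y g \<cdot> ((\<epsilon> \<diamondop> \<iota> y) \<diamondop> \<iota> g)"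
    by (simp add: Assoc_nat_left)
  also have "\<dots> = (\<l> y \<diamondop> \<iota> g) \<cdot> ((\<epsilon> \<diamondop> \<iota> y) \<diamondop> \<iota> g)"
    by (simp add: Lunit_HC1[THEN V.Cmp_extend])
  also have "\<dots> = (pcounit y \<diamondop> \<iota> g) \<cdot> (\<a> f f' y \<diamondop> \<iota> g)"
    by (simp add: pcounit_assoc flip: whisker_right)
  finally show "(pcounit (y \<star> g) \<cdot> (\<iota> f \<diamondop> \<a> f' y g) \<cdot> \<a> f (f' \<star> y) g) \<cdot> (\<a> f f' y \<diamondop> \<iota> g) =
     (pcounit y \<diamondop> \<iota> g) \<cdot> (\<a> f f' y \<diamondop> \<iota> g)" .
qed simp_all

text \<open>The same for the unit, again by the pentagon and \<open>Lunit_HC1\<close>.\<close>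

lemma punit_HC1:
  assumes [simp]: "ob y" "ob g" "Trg B y = a" "Src B y = Trg B g"
  shows "punit (y \<star> g) = (\<iota> f' \<diamondop> \<a> f y g) \<cdot> \<a> f' (f \<star> y) g \<cdot> (punit y \<diamondop> \<iota> g)"
proof -
  have "(\<iota> f' \<diamondop> \<a> f y g) \<cdot> \<a> f' (f \<star> y) g \<cdot> (punit y \<diamondop> \<iota> g) =
      \<a> f' f (y \<star> g) \<cdot> \<a> S y g \<cdot> ((\<eta> \<diamondop> \<iota> y) \<diamondop> \<iota> g) \<cdot> (vinv (\<l> y) \<diamondop> \<iota> g)"
    by (simp add: post_unit_def whisker_right pentagon_extend)
  also have "\<dots> = \<a> f' f (y \<star> g) \<cdot> (\<eta> \<diamondop> \<iota> (y \<star> g)) \<cdot> \<a> (Unit B a) y g \<cdot> (vinv (\<l> y) \<diamondop> \<iota> g)"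
    by (simp add: Assoc_nat_left')
  also have "\<a> (Unit B a) y g \<cdot> (vinv (\<l> y) \<diamondop> \<iota> g) = vinv (\<l> (y \<star> g))"
  proof (rule V.Inv_move_left[where k = "\<l> (y \<star> g)" and y = "\<iota> (y \<star> g)", THEN trans])
    show "\<l> (y \<star> g) \<cdot> \<a> (Unit B a) y g \<cdot> (vinv (\<l> y) \<diamondop> \<iota> g) = \<iota> (y \<star> g)"
      by (simp add: Lunit_HC1[THEN V.Cmp_extend] flip: whisker_right)
  qed simp_all
  finally show ?thesis by (simp add: post_unit_def)
qed

lemma precounit_natural:
  assumes "ar \<phi>" "Src B (dom\<^sub>2 \<phi>) = b" "y = cod\<^sub>2 \<phi>"
  shows "precounit y \<cdot> ((\<phi> \<diamondop> \<iota> f) \<diamondop> \<iota> f') = \<phi> \<cdot> precounit (dom\<^sub>2 \<phi>)"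
proof -
  note [simp] = assms
  have "precounit y \<cdot> ((\<phi> \<diamondop> \<iota> f) \<diamondop> \<iota> f') = \<r> y \<cdot> (\<iota> y \<diamondop> \<epsilon>) \<cdot> (\<phi> \<diamondop> \<iota> K) \<cdot> \<a> (dom\<^sub>2 \<phi>) f f'"
    by (simp add: precounit_def V.assoc Assoc_nat_left)
  also have "\<dots> = \<r> y \<cdot> (\<phi> \<diamondop> \<iota> (Unit B b)) \<cdot> (\<iota> (dom\<^sub>2 \<phi>) \<diamondop> \<epsilon>) \<cdot> \<a> (dom\<^sub>2 \<phi>) f f'"
    by (simp add: slide V.Cmp_extend[OF slide(1)] V.Cmp_extend[OF slide(2)])
  also have "\<dots> = \<phi> \<cdot> precounit (dom\<^sub>2 \<phi>)"
    by (simp add: Runit_nat[THEN V.Cmp_extend2] precounit_def)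
  finally show ?thesis .
qed

text \<open>The multiplication is defined through the action of \<open>S\<close> on \<open>f\<close>, and \<open>\<Theta>\<close> through its action on \<open>f'\<close>.
  This lemma passes from one to the other; the triangle axiom at the middle unit is what exchanges
  \<open>\<l> f\<close> for \<open>\<r> f'\<close>.\<close>

lemma m_assoc_mate: "m \<cdot> \<a> S f' f = \<mu> \<diamondop> \<iota> f"
proof -
  have "counit_f \<cdot> \<a> f f' f = \<l> f \<cdot> (\<epsilon> \<diamondop> \<iota> f)"
    by (simp add: counit_f_def V.assoc)
  then have w: "(\<iota> f' \<diamondop> counit_f) \<cdot> (\<iota> f' \<diamondop> \<a> f f' f) = (\<iota> f' \<diamondop> \<l> f) \<cdot> (\<iota> f' \<diamondop> (\<epsilon> \<diamondop> \<iota> f))"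
    by (simp flip: whisker_left)
  have "m \<cdot> \<a> S f' f = (\<iota> f' \<diamondop> counit_f) \<cdot> (\<iota> f' \<diamondop> \<a> f f' f) \<cdot> \<a> f' K f \<cdot> (\<a> f' f f' \<diamondop> \<iota> f)"
    by (simp add: m_eq V.assoc pentagon_eq)
  also have "\<dots> = (\<iota> f' \<diamondop> \<l> f) \<cdot> (\<iota> f' \<diamondop> (\<epsilon> \<diamondop> \<iota> f)) \<cdot> \<a> f' K f \<cdot> (\<a> f' f f' \<diamondop> \<iota> f)"
    by (simp add: V.Cmp_extend2[OF w])
  also have "\<dots> = (\<iota> f' \<diamondop> \<l> f) \<cdot> \<a> f' (Unit B b) f \<cdot> ((\<iota> f' \<diamondop> \<epsilon>) \<diamondop> \<iota> f) \<cdot> (\<a> f' f f' \<diamondop> \<iota> f)"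
    by (simp add: Assoc_nat_middle')
  also have "\<dots> = (\<r> f' \<diamondop> \<iota> f) \<cdot> ((\<iota> f' \<diamondop> \<epsilon>) \<diamondop> \<iota> f) \<cdot> (\<a> f' f f' \<diamondop> \<iota> f)"
    by (simp add: triangle_eq[THEN V.Cmp_extend])
  also have "\<dots> = \<mu> \<diamondop> \<iota> f"
    by (simp add: \<mu>_def whisker_right)
  finally show ?thesis .
qed

lemma \<Theta>_whisker: "\<a> f f' f \<cdot> (\<Theta> \<diamondop> \<iota> f) = (\<iota> f \<diamondop> m) \<cdot> \<a> f S S \<cdot> \<a> (f \<star> S) f' f"
proof -
  have "\<a> f f' f \<cdot> (\<Theta> \<diamondop> \<iota> f) = (\<iota> f \<diamondop> (\<mu> \<diamondop> \<iota> f)) \<cdot> \<a> f (S \<star> f') f \<cdot> (\<a> f S f' \<diamondop> \<iota> f)"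
    by (simp add: \<Theta>_def whisker_right Assoc_nat_middle')
  also have "\<dots> = (\<iota> f \<diamondop> m) \<cdot> (\<iota> f \<diamondop> \<a> S f' f) \<cdot> \<a> f (S \<star> f') f \<cdot> (\<a> f S f' \<diamondop> \<iota> f)"
    by (simp add: whisker_left V.assoc flip: m_assoc_mate)
  also have "\<dots> = (\<iota> f \<diamondop> m) \<cdot> \<a> f S S \<cdot> \<a> (f \<star> S) f' f"
    by (simp add: pentagon_eq)
  finally show ?thesis .
qed

text \<open>The two notions of invertibility of \<open>i\<close> differ only by whiskering with \<open>f'\<close>.\<close>

lemma m_left:
  assumes [simp]: "ar i" "cod\<^sub>2 i = S"
  shows "m \<cdot> (\<iota> S \<diamondop> i) = (\<iota> f' \<diamondop> (counit_f \<cdot> (\<iota> f \<diamondop> i))) \<cdot> \<a> f' f (dom\<^sub>2 i)"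
proof -
  have [simp]: "Trg B (dom\<^sub>2 i) = a" using Src_Trg_cod(2)[of i] by simp
  have "m \<cdot> (\<iota> S \<diamondop> i) = (\<iota> f' \<diamondop> counit_f) \<cdot> (\<iota> f' \<diamondop> (\<iota> f \<diamondop> i)) \<cdot> \<a> f' f (dom\<^sub>2 i)"
    by (simp add: m_eq V.assoc Assoc_nat_right[where h = f' and g = f])
  then show ?thesis by (simp add: whisker_left V.assoc)
qed

lemma m_unit: "m \<cdot> (\<iota> S \<diamondop> \<eta>) = \<r> S"
  by (simp add: m_left counit_f_unit Runit_HC1)

text \<open>Associativity of the action of \<open>S\<close> on \<open>f\<close>: since \<open>m\<close> is \<open>f' \<diamondop> counit_f\<close> up to
  associativity, it is naturality of
  \<open>pcounit\<close> at \<open>counit_f\<close>.\<close>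

lemma counit_f_m: "counit_f \<cdot> (\<iota> f \<diamondop> m) \<cdot> \<a> f S S = counit_f \<cdot> (counit_f \<diamondop> \<iota> S)"
proof -
  have n: "counit_f \<cdot> (\<iota> f \<diamondop> (\<iota> f' \<diamondop> counit_f)) = counit_f \<cdot> pcounit (f \<star> S)"
    by (rule pcounit_natural[of counit_f f, unfolded pcounit_f two_cells(2)]) simp_all
  have h: "pcounit (f \<star> S) \<cdot> (\<iota> f \<diamondop> \<a> f' f S) \<cdot> \<a> f S S = counit_f \<diamondop> \<iota> S"
    by (rule pcounit_HC1[of f S, unfolded pcounit_f]) simp_all
  have "counit_f \<cdot> (\<iota> f \<diamondop> m) \<cdot> \<a> f S S = counit_f \<cdot> (\<iota> f \<diamondop> (\<iota> f' \<diamondop> counit_f)) \<cdot> (\<iota> f \<diamondop> \<a> f' f S) \<cdot> \<a> f S S"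
    by (simp add: m_eq whisker_left V.assoc)
  also have "\<dots> = counit_f \<cdot> pcounit (f \<star> S) \<cdot> (\<iota> f \<diamondop> \<a> f' f S) \<cdot> \<a> f S S"
    by (simp add: V.Cmp_extend2[OF n])
  also have "\<dots> = counit_f \<cdot> (counit_f \<diamondop> \<iota> S)"
    by (simp add: h)
  finally show ?thesis .
qed

text \<open>Unitality of the action of \<open>S\<close> on \<open>f'\<close>, whiskered with \<open>f\<close>.\<close>

lemma \<Theta>_unit: "\<Theta> \<cdot> ((\<iota> f \<diamondop> \<eta>) \<diamondop> \<iota> f') = \<r> f \<diamondop> \<iota> f'"
proof -
  have "\<Theta> \<cdot> ((\<iota> f \<diamondop> \<eta>) \<diamondop> \<iota> f') = (\<iota> f \<diamondop> \<mu>) \<cdot> (\<iota> f \<diamondop> (\<eta> \<diamondop> \<iota> f')) \<cdot> \<a> f (Unit B a) f'"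
    by (simp add: \<Theta>_def V.assoc Assoc_nat_middle)
  also have "\<dots> = (\<iota> f \<diamondop> \<l> f') \<cdot> \<a> f (Unit B a) f'"
    by (simp add: whisker_left[symmetric, THEN V.Cmp_extend] \<mu>_unit)
  also have "\<dots> = \<r> f \<diamondop> \<iota> f'" by (simp add: triangle_eq)
  finally show ?thesis .
qed

lemma \<Theta>_assoc: "\<Theta> \<cdot> (\<a> f f' f \<diamondop> \<iota> f') = precounit K"
proof -
  have "\<Theta> \<cdot> (\<a> f f' f \<diamondop> \<iota> f') =
      (\<iota> f \<diamondop> \<r> f') \<cdot> (\<iota> f \<diamondop> (\<iota> f' \<diamondop> \<epsilon>)) \<cdot> \<a> f f' K \<cdot> \<a> K f f'"
    by (simp add: \<Theta>_def \<mu>_def whisker_left V.assoc pentagon_eq)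
  also have "\<dots> = (\<iota> f \<diamondop> \<r> f') \<cdot> \<a> f f' (Unit B b) \<cdot> (\<iota> K \<diamondop> \<epsilon>) \<cdot> \<a> K f f'"
    by (simp add: Assoc_nat_right'[where h = f and g = f'])
  also have "\<dots> = precounit K"
    by (simp add: Runit_HC1[THEN V.Cmp_extend] precounit_def)
  finally show ?thesis .
qed

text \<open>A triangle identity of the adjunction between precompositions.\<close>

lemma precounit_preunit: "precounit K \<cdot> (preunit_f \<diamondop> \<iota> f') = \<iota> K"
proof -
  have "precounit K \<cdot> (preunit_f \<diamondop> \<iota> f') = \<Theta> \<cdot> ((\<a> f f' f \<cdot> preunit_f) \<diamondop> \<iota> f')"
    by (simp add: \<Theta>_assoc[symmetric] whisker_right V.assoc)
  also have "\<dots> = (\<r> f \<diamondop> \<iota> f') \<cdot> (vinv (\<r> f) \<diamondop> \<iota> f')"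
    by (simp add: assoc_preunit_f whisker_right \<Theta>_unit[THEN V.Cmp_extend])
  also have "\<dots> = \<iota> K" by (simp flip: whisker_right)
  finally show ?thesis .
qed

section \<open>Comonoid endomorphisms as coalgebra structures\<close>

text \<open>\<open>\<theta>\<close> takes a 2-cell \<open>f \<rightarrow> f \<star> S\<close> to an endomorphism of \<open>K\<close>, and \<open>mate\<close> takes a 2-cell \<open>K \<rightarrow> y\<close> to
  its transpose \<open>f \<rightarrow> y \<star> f\<close>. For \<open>y = K\<close> they are inverse to each other up to associativity.\<close>

definition "\<theta> s = \<Theta> \<cdot> (s \<diamondop> \<iota> f')"
definition "mate \<phi> = (\<phi> \<diamondop> \<iota> f) \<cdot> preunit_f"

lemma \<theta>_ar [simp]:
  assumes "ar s" "dom\<^sub>2 s = f" "cod\<^sub>2 s = f \<star> S"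
  shows "ar (\<theta> s)" "dom\<^sub>2 (\<theta> s) = K" "cod\<^sub>2 (\<theta> s) = K"
  using assms by (simp_all add: \<theta>_def)

lemma mate_ar [simp]:
  assumes "ar \<phi>" "dom\<^sub>2 \<phi> = K" "cod\<^sub>2 \<phi> = y"
  shows "ar (mate \<phi>)" "dom\<^sub>2 (mate \<phi>) = f" "cod\<^sub>2 (mate \<phi>) = y \<star> f"
  using assms by (simp_all add: mate_def)

lemma precounit_mate:
  assumes [simp]: "ar \<phi>" "dom\<^sub>2 \<phi> = K" "cod\<^sub>2 \<phi> = y"
  shows "precounit y \<cdot> (mate \<phi> \<diamondop> \<iota> f') = \<phi>"
proof -
  have [simp]: "Src B y = b" "ob y" using Src_Trg_cod(1)[of \<phi>] V.Cod_in[of \<phi>] by simp_all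
  have "precounit y \<cdot> (mate \<phi> \<diamondop> \<iota> f') = \<phi> \<cdot> precounit K \<cdot> (preunit_f \<diamondop> \<iota> f')"
    by (simp add: mate_def whisker_right precounit_natural[THEN V.Cmp_extend2])
  then show ?thesis by (simp add: precounit_preunit)
qed

lemma mate_inj:
  assumes "ar \<phi>" "dom\<^sub>2 \<phi> = K" "ar \<psi>" "dom\<^sub>2 \<psi> = K" "cod\<^sub>2 \<phi> = cod\<^sub>2 \<psi>" "mate \<phi> = mate \<psi>"
  shows "\<phi> = \<psi>"
  using precounit_mate[OF assms(1,2,5)] precounit_mate[OF assms(3,4) refl] unfolding assms(6) by (rule trans[OF sym])

text \<open>Once \<open>s\<close> is applied first, what remains is the right unit law \<open>m_unit\<close> of \<open>S\<close>.\<close>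

lemma mate_\<theta>:
  assumes [simp]: "ar s" "dom\<^sub>2 s = f" "cod\<^sub>2 s = f \<star> S"
  shows "\<a> f f' f \<cdot> mate (\<theta> s) = s"
proof -
  have "\<a> f f' f \<cdot> mate (\<theta> s) = \<a> f f' f \<cdot> (\<Theta> \<diamondop> \<iota> f) \<cdot> ((s \<diamondop> \<iota> f') \<diamondop> \<iota> f) \<cdot> preunit_f"
    by (simp add: mate_def \<theta>_def whisker_right V.assoc)
  also have "\<dots> = (\<iota> f \<diamondop> m) \<cdot> \<a> f S S \<cdot> \<a> (f \<star> S) f' f \<cdot> ((s \<diamondop> \<iota> f') \<diamondop> \<iota> f) \<cdot> preunit_f"
    by (simp add: V.Cmp_extend[OF \<Theta>_whisker] V.assoc)
  also have "\<dots> = (\<iota> f \<diamondop> m) \<cdot> \<a> f S S \<cdot> (s \<diamondop> \<iota> S) \<cdot> (\<iota> f \<diamondop> \<eta>) \<cdot> vinv (\<r> f)"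
    by (simp add: Assoc_nat_left' assoc_preunit_f)
  also have "\<dots> = (\<iota> f \<diamondop> m) \<cdot> \<a> f S S \<cdot> (\<iota> (f \<star> S) \<diamondop> \<eta>) \<cdot> (s \<diamondop> \<iota> (Unit B a)) \<cdot> vinv (\<r> f)"
    by (simp add: V.Cmp_extend[OF slide(1)] V.Cmp_extend[OF slide(2)])
  also have "\<dots> = ((\<iota> f \<diamondop> m) \<cdot> (\<iota> f \<diamondop> (\<iota> S \<diamondop> \<eta>))) \<cdot> \<a> f S (Unit B a) \<cdot> (s \<diamondop> \<iota> (Unit B a)) \<cdot> vinv (\<r> f)"
    by (simp add: Assoc_nat_right'[where h = f and g = S] V.assoc)
  also have "(\<iota> f \<diamondop> m) \<cdot> (\<iota> f \<diamondop> (\<iota> S \<diamondop> \<eta>)) = \<iota> f \<diamondop> \<r> S"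
    by (simp add: m_unit flip: whisker_left)
  also have "(\<iota> f \<diamondop> \<r> S) \<cdot> \<a> f S (Unit B a) \<cdot> (s \<diamondop> \<iota> (Unit B a)) \<cdot> vinv (\<r> f) = s"
    by (simp add: Runit_HC1[THEN V.Cmp_extend] Runit_nat[THEN V.Cmp_extend2])
  finally show ?thesis .
qed

lemma \<theta>_mate:
  assumes [simp]: "ar \<phi>" "dom\<^sub>2 \<phi> = K" "cod\<^sub>2 \<phi> = K"
  shows "\<theta> (\<a> f f' f \<cdot> mate \<phi>) = \<phi>"
  using precounit_mate[OF assms] by (simp add: \<theta>_def whisker_right V.Cmp_extend[OF \<Theta>_assoc])

text \<open>The comultiplications of the comonads \<open>f \<star> (f' \<star> -)\<close> and \<open>K \<star> -\<close> agree at \<open>f\<close> up to the associativity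
  isomorphism between them.\<close>

lemma \<delta>_whisker:
  "(\<iota> f \<diamondop> punit S) \<cdot> \<a> f f' f =
     \<a> f f' (f \<star> S) \<cdot> (\<iota> K \<diamondop> \<a> f f' f) \<cdot> \<a> K K f \<cdot> (\<delta> \<diamondop> \<iota> f)"
proof -
  have "(\<iota> f \<diamondop> punit S) \<cdot> \<a> f f' f =
      (\<iota> f \<diamondop> (\<iota> f' \<diamondop> \<a> f f' f)) \<cdot> (\<iota> f \<diamondop> \<a> f' K f) \<cdot> (\<iota> f \<diamondop> (punit f' \<diamondop> \<iota> f)) \<cdot> \<a> f f' f"
    by (simp add: punit_HC1 whisker_left V.assoc)
  also have "\<dots> = (\<iota> f \<diamondop> (\<iota> f' \<diamondop> \<a> f f' f)) \<cdot> (\<iota> f \<diamondop> \<a> f' K f) \<cdot> \<a> f (f' \<star> K) f \<cdot> ((\<iota> f \<diamondop> punit f') \<diamondop> \<iota> f)"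
    by (simp add: Assoc_nat_middle)
  also have "\<dots> = (\<iota> f \<diamondop> (\<iota> f' \<diamondop> \<a> f f' f)) \<cdot> (\<iota> f \<diamondop> \<a> f' K f) \<cdot> \<a> f (f' \<star> K) f \<cdot> (\<a> f f' K \<diamondop> \<iota> f) \<cdot> (\<delta> \<diamondop> \<iota> f)"
    by (simp add: whisker_right flip: \<delta>_eq)
  also have "\<dots> = (\<iota> f \<diamondop> (\<iota> f' \<diamondop> \<a> f f' f)) \<cdot> \<a> f f' (K \<star> f) \<cdot> \<a> K K f \<cdot> (\<delta> \<diamondop> \<iota> f)"
    by (simp add: pentagon_extend)
  also have "\<dots> = \<a> f f' (f \<star> S) \<cdot> (\<iota> K \<diamondop> \<a> f f' f) \<cdot> \<a> K K f \<cdot> (\<delta> \<diamondop> \<iota> f)"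
    by (simp add: Assoc_nat_right'[where h = f and g = f'])
  finally show ?thesis .
qed

text \<open>Coassociativity of \<open>\<a> f f' f \<cdot> t\<close> for the comonad \<open>f \<star> (f' \<star> -)\<close> is that of \<open>t\<close> for \<open>K \<star> -\<close>: both
  sides differ by the same invertible 2-cell.\<close>

lemma coassoc_iff:
  assumes [simp]: "ar t" "dom\<^sub>2 t = f" "cod\<^sub>2 t = K \<star> f"
  shows "(\<iota> f \<diamondop> punit S) \<cdot> (\<a> f f' f \<cdot> t) = (\<iota> f \<diamondop> (\<iota> f' \<diamondop> (\<a> f f' f \<cdot> t))) \<cdot> (\<a> f f' f \<cdot> t) \<longleftrightarrow>
    \<a> K K f \<cdot> (\<delta> \<diamondop> \<iota> f) \<cdot> t = (\<iota> K \<diamondop> t) \<cdot> t"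
proof -
  let ?p = "\<a> f f' (f \<star> S) \<cdot> (\<iota> K \<diamondop> \<a> f f' f)"
  have l: "(\<iota> f \<diamondop> punit S) \<cdot> (\<a> f f' f \<cdot> t) = ?p \<cdot> (\<a> K K f \<cdot> (\<delta> \<diamondop> \<iota> f) \<cdot> t)"
    by (simp add: V.Cmp_extend[OF \<delta>_whisker] V.assoc)
  have r: "(\<iota> f \<diamondop> (\<iota> f' \<diamondop> (\<a> f f' f \<cdot> t))) \<cdot> (\<a> f f' f \<cdot> t) = ?p \<cdot> ((\<iota> K \<diamondop> t) \<cdot> t)"
    by (simp add: whisker_left V.assoc Assoc_nat_right'[where h = f and g = f', symmetric]
        Assoc_nat_right'[where h = f and g = f'])
  have iso: "iso\<^sub>2 ?p" by (simp add: V.iso_Cmp)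
  show ?thesis unfolding l r
  proof
    assume "?p \<cdot> (\<a> K K f \<cdot> (\<delta> \<diamondop> \<iota> f) \<cdot> t) = ?p \<cdot> ((\<iota> K \<diamondop> t) \<cdot> t)"
    then show "\<a> K K f \<cdot> (\<delta> \<diamondop> \<iota> f) \<cdot> t = (\<iota> K \<diamondop> t) \<cdot> t"
      by (rule V.iso_cancel_left[OF iso, rotated -1]) simp_all
  qed simp
qed

text \<open>Both equations are transposes of each other, as \<open>mate \<epsilon>\<close> is the inverse of \<open>\<l> f\<close>.\<close>

lemma counit_iff:
  assumes [simp]: "ar \<phi>" "dom\<^sub>2 \<phi> = K" "cod\<^sub>2 \<phi> = K"
  shows "counit_f \<cdot> (\<a> f f' f \<cdot> mate \<phi>) = \<iota> f \<longleftrightarrow> \<epsilon> \<cdot> \<phi> = \<epsilon>"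
proof -
  have ev: "counit_f \<cdot> (\<a> f f' f \<cdot> t) = \<l> f \<cdot> (\<epsilon> \<diamondop> \<iota> f) \<cdot> t" if [simp]: "ar t" "dom\<^sub>2 t = f" "cod\<^sub>2 t = K \<star> f" for t
    by (simp add: counit_f_def V.assoc)
  have l: "counit_f \<cdot> (\<a> f f' f \<cdot> mate \<phi>) = \<l> f \<cdot> mate (\<epsilon> \<cdot> \<phi>)"
    by (simp add: ev) (simp add: mate_def whisker_right V.assoc)
  have r: "\<iota> f = \<l> f \<cdot> mate \<epsilon>"
  proof -
    have "\<l> f \<cdot> mate \<epsilon> = counit_f \<cdot> (\<iota> f \<diamondop> \<eta>) \<cdot> vinv (\<r> f)"
      by (simp add: mate_def flip: ev assoc_preunit_f)
    then show ?thesis by (simp add: V.Cmp_extend[OF counit_f_unit])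
  qed
  show ?thesis
  proof
    assume "counit_f \<cdot> (\<a> f f' f \<cdot> mate \<phi>) = \<iota> f"
    then have "\<l> f \<cdot> mate (\<epsilon> \<cdot> \<phi>) = \<l> f \<cdot> mate \<epsilon>" unfolding l r[symmetric] .
    then have "mate (\<epsilon> \<cdot> \<phi>) = mate \<epsilon>"
      by (rule V.iso_cancel_left[rotated -1]) simp_all
    then show "\<epsilon> \<cdot> \<phi> = \<epsilon>"
      by (rule mate_inj[rotated -1]) simp_all
  next
    assume "\<epsilon> \<cdot> \<phi> = \<epsilon>"
    then show "counit_f \<cdot> (\<a> f f' f \<cdot> mate \<phi>) = \<iota> f" unfolding l by (simp flip: r)
  qed
qed

text \<open>\<open>mate (\<delta> \<cdot> \<phi>)\<close> is \<open>(\<delta> \<diamondop> f) \<cdot> mate \<phi>\<close>. For the other side, \<open>\<delta>\<close> is first moved to \<open>preunit_f\<close>, where coassociativity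
  of that coalgebra (the hypothesis) applies; this leaves one copy of \<open>\<phi>\<close> to form each \<open>mate \<phi>\<close>.\<close>

lemma comult_iff:
  assumes [simp]: "ar \<phi>" "dom\<^sub>2 \<phi> = K" "cod\<^sub>2 \<phi> = K"
    and cc: "\<a> K K f \<cdot> (\<delta> \<diamondop> \<iota> f) \<cdot> preunit_f = (\<iota> K \<diamondop> preunit_f) \<cdot> preunit_f"
  shows "\<a> K K f \<cdot> (\<delta> \<diamondop> \<iota> f) \<cdot> mate \<phi> = (\<iota> K \<diamondop> mate \<phi>) \<cdot> mate \<phi> \<longleftrightarrow> \<delta> \<cdot> \<phi> = (\<phi> \<diamondop> \<phi>) \<cdot> \<delta>"
proof -
  have l: "\<a> K K f \<cdot> (\<delta> \<diamondop> \<iota> f) \<cdot> mate \<phi> = \<a> K K f \<cdot> mate (\<delta> \<cdot> \<phi>)"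
    by (simp add: mate_def whisker_right V.assoc)
  have "\<a> K K f \<cdot> mate ((\<phi> \<diamondop> \<phi>) \<cdot> \<delta>) = (\<phi> \<diamondop> (\<phi> \<diamondop> \<iota> f)) \<cdot> (\<a> K K f \<cdot> (\<delta> \<diamondop> \<iota> f) \<cdot> preunit_f)"
    by (simp add: mate_def whisker_right V.assoc Assoc_nat_at[THEN V.Cmp_extend2])
  also have "\<dots> = (\<phi> \<diamondop> mate \<phi>) \<cdot> preunit_f"
    by (simp add: cc mate_def interchange_eq[THEN V.Cmp_extend])
  also have "\<dots> = (\<iota> K \<diamondop> mate \<phi>) \<cdot> (\<phi> \<diamondop> \<iota> f) \<cdot> preunit_f"
    by (simp add: slide[THEN V.Cmp_extend])
  finally have r: "(\<iota> K \<diamondop> mate \<phi>) \<cdot> mate \<phi> = \<a> K K f \<cdot> mate ((\<phi> \<diamondop> \<phi>) \<cdot> \<delta>)"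
    by (simp flip: mate_def)
  show ?thesis
  proof
    assume "\<a> K K f \<cdot> (\<delta> \<diamondop> \<iota> f) \<cdot> mate \<phi> = (\<iota> K \<diamondop> mate \<phi>) \<cdot> mate \<phi>"
    then have "\<a> K K f \<cdot> mate (\<delta> \<cdot> \<phi>) = \<a> K K f \<cdot> mate ((\<phi> \<diamondop> \<phi>) \<cdot> \<delta>)" unfolding l r .
    then have "mate (\<delta> \<cdot> \<phi>) = mate ((\<phi> \<diamondop> \<phi>) \<cdot> \<delta>)"
      by (rule V.iso_cancel_left[rotated -1]) simp_all
    then show "\<delta> \<cdot> \<phi> = (\<phi> \<diamondop> \<phi>) \<cdot> \<delta>"
      by (rule mate_inj[rotated -1]) simp_all
  next
    assume "\<delta> \<cdot> \<phi> = (\<phi> \<diamondop> \<phi>) \<cdot> \<delta>"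
    then show "\<a> K K f \<cdot> (\<delta> \<diamondop> \<iota> f) \<cdot> mate \<phi> = (\<iota> K \<diamondop> mate \<phi>) \<cdot> mate \<phi>"
      unfolding l r by simp
  qed
qed

section \<open>Products of invertible subobjects\<close>

abbreviation "\<xi> i \<equiv> counit_f \<cdot> (\<iota> f \<diamondop> i)"
definition "coact i = (\<iota> f \<diamondop> i) \<cdot> vinv (\<xi> i)"
definition "xi_invertible i \<longleftrightarrow> ar i \<and> cod\<^sub>2 i = S \<and> iso\<^sub>2 (\<xi> i)"

lemma xi_invertible_simps:
  assumes "xi_invertible i"
  shows "ar i" "cod\<^sub>2 i = S" "iso\<^sub>2 (\<xi> i)" "ob (dom\<^sub>2 i)" "Src B (dom\<^sub>2 i) = a" "Trg B (dom\<^sub>2 i) = a"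
  using assms Src_Trg_cod[of i] by (auto simp: xi_invertible_def)

lemma coact_ar [simp]:
  assumes "xi_invertible i"
  shows "ar (coact i)" "dom\<^sub>2 (coact i) = f" "cod\<^sub>2 (coact i) = f \<star> S"
  using xi_invertible_simps[OF assms] by (simp_all add: coact_def)

lemma coact_\<xi>:
  assumes "xi_invertible i"
  shows "coact i \<cdot> \<xi> i = \<iota> f \<diamondop> i"
  using xi_invertible_simps[OF assms] V.Inv_arr[of "\<xi> i"] by (simp add: coact_def V.assoc)

text \<open>Associativity of the action \<open>counit_f\<close>, followed by sliding \<open>\<xi> i\<close> past \<open>j\<close>.\<close>

lemma \<xi>_product:
  assumes "xi_invertible i" "xi_invertible j"
  shows "\<xi> (m \<cdot> (i \<diamondop> j)) \<cdot> \<a> f (dom\<^sub>2 i) (dom\<^sub>2 j) = \<xi> j \<cdot> (\<xi> i \<diamondop> \<iota> (dom\<^sub>2 j))"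
proof -
  note [simp] = xi_invertible_simps(1,2,4-6)[OF assms(1)] xi_invertible_simps(1,2,4-6)[OF assms(2)]
  have "\<xi> (m \<cdot> (i \<diamondop> j)) \<cdot> \<a> f (dom\<^sub>2 i) (dom\<^sub>2 j) = (counit_f \<cdot> (\<iota> f \<diamondop> m) \<cdot> \<a> f S S) \<cdot> ((\<iota> f \<diamondop> i) \<diamondop> j)"
    by (simp add: whisker_left V.assoc Assoc_nat_at)
  also have "\<dots> = counit_f \<cdot> (counit_f \<diamondop> \<iota> S) \<cdot> ((\<iota> f \<diamondop> i) \<diamondop> j)"
    by (simp add: counit_f_m V.assoc)
  also have "\<dots> = counit_f \<cdot> (\<xi> i \<diamondop> j)"
    by (simp add: interchange_eq)
  also have "\<dots> = \<xi> j \<cdot> (\<xi> i \<diamondop> \<iota> (dom\<^sub>2 j))"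
    by (simp add: V.assoc slide)
  finally show ?thesis .
qed

lemma xi_invertible_product:
  assumes "xi_invertible i" "xi_invertible j"
  shows "xi_invertible (m \<cdot> (i \<diamondop> j))"
proof -
  note [simp] = xi_invertible_simps[OF assms(1)] xi_invertible_simps[OF assms(2)]
  have "\<xi> (m \<cdot> (i \<diamondop> j)) = (\<xi> j \<cdot> (\<xi> i \<diamondop> \<iota> (dom\<^sub>2 j))) \<cdot> vinv (\<a> f (dom\<^sub>2 i) (dom\<^sub>2 j))"
    by (rule V.Inv_move_right[OF _ _ _ \<xi>_product[OF assms]]) simp_all
  moreover have q: "iso\<^sub>2 (\<xi> j \<cdot> (\<xi> i \<diamondop> \<iota> (dom\<^sub>2 j)))"
    by (rule V.iso_Cmp(1)) simp_all
  moreover have "iso\<^sub>2 ((\<xi> j \<cdot> (\<xi> i \<diamondop> \<iota> (dom\<^sub>2 j))) \<cdot> vinv (\<a> f (dom\<^sub>2 i) (dom\<^sub>2 j)))"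
    by (rule V.iso_Cmp(1)[OF _ q]) simp_all
  ultimately show ?thesis by (simp add: xi_invertible_def)
qed

text \<open>Here \<open>coact i\<close> enters only through \<open>\<theta> (coact i)\<close>. Both sides are compared after composing with the
  invertible \<open>\<xi> (m \<cdot> (i \<diamondop> j))\<close>, which \<open>\<xi>_product\<close> factors so that \<open>coact j \<cdot> \<xi> j = f \<diamondop> j\<close> and
  \<open>coact i \<cdot> \<xi> i = f \<diamondop> i\<close> can be used in turn.\<close>

lemma coact_product:
  assumes "xi_invertible i" "xi_invertible j"
  shows "coact (m \<cdot> (i \<diamondop> j)) = \<a> f f' f \<cdot> (\<theta> (coact i) \<diamondop> \<iota> f) \<cdot> vinv (\<a> f f' f) \<cdot> coact j"
proof -
  note [simp] = xi_invertible_simps(1,2,4-6)[OF assms(1)] xi_invertible_simps(1,2,4-6)[OF assms(2)] coact_ar[OF assms(1)] coact_ar[OF assms(2)]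
  note p = xi_invertible_product[OF assms]
  let ?h = "dom\<^sub>2 i" let ?k = "dom\<^sub>2 j"
  have "\<theta> (coact i) \<cdot> (\<xi> i \<diamondop> \<iota> f') = \<Theta> \<cdot> ((\<iota> f \<diamondop> i) \<diamondop> \<iota> f')"
    by (simp add: \<theta>_def coact_\<xi>[OF assms(1)] V.assoc flip: whisker_right)
  then have t: "(\<theta> (coact i) \<diamondop> \<iota> f) \<cdot> ((\<xi> i \<diamondop> \<iota> f') \<diamondop> \<iota> f) = (\<Theta> \<diamondop> \<iota> f) \<cdot> (((\<iota> f \<diamondop> i) \<diamondop> \<iota> f') \<diamondop> \<iota> f)"
    by (simp flip: whisker_right)
  have n: "(\<xi> i \<diamondop> \<iota> S) \<cdot> \<a> (f \<star> ?h) f' f = \<a> f f' f \<cdot> ((\<xi> i \<diamondop> \<iota> f') \<diamondop> \<iota> f)"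
    by (simp add: Assoc_nat_left)
  have "\<a> f f' f \<cdot> (\<theta> (coact i) \<diamondop> \<iota> f) \<cdot> vinv (\<a> f f' f) \<cdot> (\<xi> i \<diamondop> \<iota> S) \<cdot> \<a> (f \<star> ?h) f' f =
      \<a> f f' f \<cdot> (\<theta> (coact i) \<diamondop> \<iota> f) \<cdot> ((\<xi> i \<diamondop> \<iota> f') \<diamondop> \<iota> f)"
    by (simp add: n)
  also have "\<dots> = (\<iota> f \<diamondop> m) \<cdot> \<a> f S S \<cdot> \<a> (f \<star> S) f' f \<cdot> (((\<iota> f \<diamondop> i) \<diamondop> \<iota> f') \<diamondop> \<iota> f)"
    by (simp add: t V.Cmp_extend[OF \<Theta>_whisker] V.assoc)
  also have "\<dots> = (\<iota> f \<diamondop> m) \<cdot> \<a> f S S \<cdot> ((\<iota> f \<diamondop> i) \<diamondop> \<iota> S) \<cdot> \<a> (f \<star> ?h) f' f"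
    by (simp add: Assoc_nat_left)
  finally have "(\<a> f f' f \<cdot> (\<theta> (coact i) \<diamondop> \<iota> f) \<cdot> vinv (\<a> f f' f) \<cdot> (\<xi> i \<diamondop> \<iota> S)) \<cdot> \<a> (f \<star> ?h) f' f =
      ((\<iota> f \<diamondop> m) \<cdot> \<a> f S S \<cdot> ((\<iota> f \<diamondop> i) \<diamondop> \<iota> S)) \<cdot> \<a> (f \<star> ?h) f' f"
    by (simp add: V.assoc)
  then have *: "\<a> f f' f \<cdot> (\<theta> (coact i) \<diamondop> \<iota> f) \<cdot> vinv (\<a> f f' f) \<cdot> (\<xi> i \<diamondop> \<iota> S) =
      (\<iota> f \<diamondop> m) \<cdot> \<a> f S S \<cdot> ((\<iota> f \<diamondop> i) \<diamondop> \<iota> S)"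
    by (rule V.iso_cancel_right[rotated -1]) simp_all
  \<comment> \<open>\<open>?c\<close> is the endomorphism \<open>\<theta> (coact i) \<diamondop> f\<close> transported to \<open>f \<star> S\<close>.\<close>
  let ?c = "\<a> f f' f \<cdot> (\<theta> (coact i) \<diamondop> \<iota> f) \<cdot> vinv (\<a> f f' f)"
  have "(?c \<cdot> coact j) \<cdot> \<xi> (m \<cdot> (i \<diamondop> j)) \<cdot> \<a> f ?h ?k = ?c \<cdot> (coact j \<cdot> \<xi> j) \<cdot> (\<xi> i \<diamondop> \<iota> ?k)"
    unfolding \<xi>_product[OF assms] by (simp add: V.assoc)
  also have "\<dots> = ?c \<cdot> (\<xi> i \<diamondop> \<iota> S) \<cdot> (\<iota> (f \<star> ?h) \<diamondop> j)"
    by (simp add: coact_\<xi>[OF assms(2)] slide)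
  also have "\<dots> = (?c \<cdot> (\<xi> i \<diamondop> \<iota> S)) \<cdot> (\<iota> (f \<star> ?h) \<diamondop> j)"
    by (simp add: V.assoc)
  also have "\<dots> = (\<iota> f \<diamondop> m) \<cdot> \<a> f S S \<cdot> ((\<iota> f \<diamondop> i) \<diamondop> j)"
    using * by (simp add: V.assoc slide)
  also have "\<dots> = (\<iota> f \<diamondop> (m \<cdot> (i \<diamondop> j))) \<cdot> \<a> f ?h ?k"
    by (simp add: whisker_left V.assoc Assoc_nat_at)
  finally have "((?c \<cdot> coact j) \<cdot> \<xi> (m \<cdot> (i \<diamondop> j))) \<cdot> \<a> f ?h ?k = (\<iota> f \<diamondop> (m \<cdot> (i \<diamondop> j))) \<cdot> \<a> f ?h ?k"
    by (simp add: V.assoc)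
  then have "(?c \<cdot> coact j) \<cdot> \<xi> (m \<cdot> (i \<diamondop> j)) = \<iota> f \<diamondop> (m \<cdot> (i \<diamondop> j))"
    by (rule V.iso_cancel_right[rotated -1]) simp_all
  also have "\<dots> = coact (m \<cdot> (i \<diamondop> j)) \<cdot> \<xi> (m \<cdot> (i \<diamondop> j))"
    by (simp add: coact_\<xi>[OF p])
  finally have "?c \<cdot> coact j = coact (m \<cdot> (i \<diamondop> j))"
    by (rule V.iso_cancel_right[OF xi_invertible_simps(3)[OF p], rotated -1]) (simp_all add: p)
  then show ?thesis by (simp add: V.assoc)
qed

text \<open>By \<open>coact_product\<close> and naturality of \<open>precounit\<close>, \<open>\<theta> (coact i)\<close> can be pulled out to the left.\<close>

lemma \<theta>_product:
  assumes "xi_invertible i" "xi_invertible j"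
  shows "\<theta> (coact (m \<cdot> (i \<diamondop> j))) = \<theta> (coact i) \<cdot> \<theta> (coact j)"
proof -
  note [simp] = coact_ar[OF assms(1)] coact_ar[OF assms(2)]
  let ?t = "vinv (\<a> f f' f) \<cdot> coact j"
  have "\<theta> (coact (m \<cdot> (i \<diamondop> j))) = precounit K \<cdot> ((\<theta> (coact i) \<diamondop> \<iota> f) \<diamondop> \<iota> f') \<cdot> (?t \<diamondop> \<iota> f')"
    by (simp add: coact_product[OF assms]) (subst \<theta>_def, simp add: whisker_right V.Cmp_extend[OF \<Theta>_assoc])
  also have "\<dots> = \<theta> (coact i) \<cdot> precounit K \<cdot> (?t \<diamondop> \<iota> f')"
    by (simp add: precounit_natural[THEN V.Cmp_extend2])
  also have "precounit K \<cdot> (?t \<diamondop> \<iota> f') = \<theta> (coact j)"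
    by (simp add: \<Theta>_assoc[symmetric] V.assoc \<theta>_def flip: whisker_right)
  finally show ?thesis .
qed

lemma xi_invertible_unit: "xi_invertible \<eta>"
  by (simp add: xi_invertible_def counit_f_unit)

lemma coact_unit: "coact \<eta> = \<a> f f' f \<cdot> preunit_f"
  by (simp add: coact_def counit_f_unit assoc_preunit_f)

lemma \<theta>_unit: "\<theta> (coact \<eta>) = \<iota> K"
  using \<theta>_mate[of "\<iota> K"] by (simp add: coact_unit mate_def)

lemma adj_xi_eq:
  assumes "ar i" "cod\<^sub>2 i = S"
  shows "adj_xi B f f' \<epsilon> i = \<xi> i"
  using assms Src_Trg_cod[of i] by (simp add: adj_xi_def counit_f_def V.assoc)

lemma adj_theta_eq:
  assumes "xi_invertible i"
  shows "adj_theta B f f' \<epsilon> i = \<theta> (coact i)"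
  using xi_invertible_simps[OF assms] V.Inv_arr[of "\<xi> i"]
  by (simp add: adj_theta_def adj_xi_eq \<theta>_def coact_def \<Theta>_def \<mu>_def whisker_left whisker_right V.assoc)

end

section \<open>The isomorphism\<close>

locale comonadic_internal_adjunction = internal_adjunction +
  assumes comonadic: "comonadic (hom_cat B a a) (hom_cat B a b) (post_func B f) (post_func B f') punit pcounit"

sublocale comonadic_internal_adjunction \<subseteq>
  A: comonadic_adjunction "hom_cat B a a" "hom_cat B a b" "post_func B f" "post_func B f'" punit pcounit
proof (intro comonadic_adjunction.intro adjoint_functors.intro)
  show "adjoint_functors_axioms (hom_cat B a a) (hom_cat B a b) (post_func B f) (post_func B f') punit pcounit"
    "comonadic_adjunction_axioms (hom_cat B a a) (hom_cat B a b) (post_func B f) (post_func B f') punit pcounit"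
    using comonadic by (simp_all add: comonadic_def adjoint_functors_axioms_def comonadic_adjunction_axioms_def)
qed (rule category_hom_cat)+

context comonadic_internal_adjunction
begin

abbreviation "sub \<equiv> subobject (hom_cat B a a)"

lemma post_func_simps [simp]:
  "on_ob (post_func B g) h = g \<star> h" "on_ar (post_func B g) \<tau> = \<iota> g \<diamondop> \<tau>"
  by (simp_all add: post_func_def)

lemma transpose_eq: "A.transpose f i = \<xi> i"
  by (simp add: A.transpose_def pcounit_f)

lemma \<xi>_in_hom: "ar i \<Longrightarrow> cod\<^sub>2 i = S \<Longrightarrow> \<xi> i \<in> Ar (hom_cat B a b)"
  using Src_Trg_cod[of i] by (simp add: hom_cat_Ar_iff)

lemma transpose_invertible_iff: "A.transpose_invertible f i \<longleftrightarrow> xi_invertible i"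
proof (cases "ar i \<and> cod\<^sub>2 i = S")
  case True
  then have [simp]: "ar i" "cod\<^sub>2 i = S" "Src B (dom\<^sub>2 i) = a" "Trg B (dom\<^sub>2 i) = a"
    using Src_Trg_cod[of i] by auto
  show ?thesis
    by (simp add: A.transpose_invertible_def transpose_eq xi_invertible_def hom_cat_iso_iff hom_cat_Ar_iff)
qed (auto simp: A.transpose_invertible_def xi_invertible_def hom_cat_Ar_iff)

lemma coaction_eq: "xi_invertible i \<Longrightarrow> A.coaction f i = coact i"
  by (simp add: A.coaction_def transpose_eq coact_def hom_cat_Inv \<xi>_in_hom xi_invertible_def)

lemma f_Hom1: "f \<in> Hom1 a b"
  by (simp add: Hom1_iff)

text \<open>The comonad in \<open>A.coalg\<close> is kept behind a constant: rewriting the functors inside it would hide the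
  pattern from the rules about \<open>A.coalg\<close>.\<close>

definition "f_coalgebra s \<longleftrightarrow> A.coalg (f, s)"

lemma f_coalgebra_iff:
  "f_coalgebra s \<longleftrightarrow> ar s \<and> dom\<^sub>2 s = f \<and> cod\<^sub>2 s = f \<star> S \<and> counit_f \<cdot> s = \<iota> f \<and>
     (\<iota> f \<diamondop> punit S) \<cdot> s = (\<iota> f \<diamondop> (\<iota> f' \<diamondop> s)) \<cdot> s"
  unfolding f_coalgebra_def A.coalg_iff
  by (cases "dom\<^sub>2 s = f") (simp_all add: hom_cat_Ar_iff Hom1_iff pcounit_f)

lemma f_coalgebra_coact: "xi_invertible i \<Longrightarrow> f_coalgebra (coact i)"
  unfolding f_coalgebra_def using A.coalgebra_coaction[of f i] by (simp add: transpose_invertible_iff coaction_eq f_Hom1)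

text \<open>\<open>preunit_f\<close> is the coaction of the unit \<open>\<eta>\<close>, hence a coalgebra.\<close>

lemma preunit_f_coassoc: "\<a> K K f \<cdot> (\<delta> \<diamondop> \<iota> f) \<cdot> preunit_f = (\<iota> K \<diamondop> preunit_f) \<cdot> preunit_f"
  using f_coalgebra_coact[OF xi_invertible_unit] coassoc_iff[of preunit_f] by (simp add: f_coalgebra_iff coact_unit)

abbreviation "endo \<phi> \<equiv> \<phi> \<in> carrier (comonoid_End B (adj_comonoid B f f' \<eta> \<epsilon>))"

lemma endo_iff:
  "endo \<phi> \<longleftrightarrow> ar \<phi> \<and> dom\<^sub>2 \<phi> = K \<and> cod\<^sub>2 \<phi> = K \<and> f_coalgebra (\<a> f f' f \<cdot> mate \<phi>)"
proof -
  have "\<epsilon> \<cdot> \<phi> = \<epsilon> \<and> \<delta> \<cdot> \<phi> = (\<phi> \<diamondop> \<phi>) \<cdot> \<delta> \<longleftrightarrow> f_coalgebra (\<a> f f' f \<cdot> mate \<phi>)"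
    if [simp]: "ar \<phi>" "dom\<^sub>2 \<phi> = K" "cod\<^sub>2 \<phi> = K"
    using counit_iff[OF that] comult_iff[OF that preunit_f_coassoc] coassoc_iff[of "mate \<phi>"]
    by (simp add: f_coalgebra_iff)
  then show ?thesis
    by (auto simp: comonoid_End_def adj_comonoid_def V.Hom_iff)
qed

text \<open>From right to left, monicity comes from comonadicity. From left to right, \<open>f' \<star> -\<close> reflects the
  invertibility of \<open>\<xi> i\<close> because the coaction of \<open>\<eta>\<close> is a section of the counit at \<open>f\<close>.\<close>

lemma left_invertible_iff: "left_invertible B a (adj_monoid B f f' \<eta> \<epsilon>) i \<longleftrightarrow> xi_invertible i"
proof
  assume "xi_invertible i"
  note [simp] = xi_invertible_simps[OF this]
  have "is_mono (hom_cat B a a) i"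
    by (rule A.transpose_invertible_mono[of f]) (simp_all add: f_Hom1 transpose_invertible_iff \<open>xi_invertible i\<close>)
  moreover have "iso\<^sub>2 (m \<cdot> (\<iota> S \<diamondop> i))"
    by (subst m_left) (simp_all add: V.iso_Cmp(1))
  ultimately show "left_invertible B a (adj_monoid B f f' \<eta> \<epsilon>) i"
    by (simp add: left_invertible_def adj_monoid_def hom_cat_iso_iff hom_cat_Ar_iff)
next
  assume l: "left_invertible B a (adj_monoid B f f' \<eta> \<epsilon>) i"
  then have [simp]: "ar i" "cod\<^sub>2 i = S" "Src B (dom\<^sub>2 i) = a" "Trg B (dom\<^sub>2 i) = a"
    and iso: "iso\<^sub>2 (m \<cdot> (\<iota> S \<diamondop> i))"
    by (auto simp: left_invertible_def adj_monoid_def is_mono_def hom_cat_iso_iff hom_cat_Ar_iff)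
  have "\<iota> f' \<diamondop> \<xi> i = (m \<cdot> (\<iota> S \<diamondop> i)) \<cdot> vinv (\<a> f' f (dom\<^sub>2 i))"
    by (rule V.Inv_move_right) (simp_all add: m_left)
  moreover have "iso\<^sub>2 ((m \<cdot> (\<iota> S \<diamondop> i)) \<cdot> vinv (\<a> f' f (dom\<^sub>2 i)))"
    by (rule V.iso_Cmp(1)[OF _ iso]) simp_all
  ultimately have U: "is_isomorphism (hom_cat B a a) (on_ar (post_func B f') (\<xi> i))"
    by (simp add: hom_cat_iso_iff hom_cat_Ar_iff)
  have "is_isomorphism (hom_cat B a b) (\<xi> i)"
    by (rule A.U_reflects_iso[OF _ _ _ _ _ _ _ _ _ U, of f "coact \<eta>" "dom\<^sub>2 i"])
      (use f_coalgebra_coact[OF xi_invertible_unit] in \<open>simp_all add: f_Hom1 Hom1_iff hom_cat_Ar_iff f_coalgebra_iff pcounit_f xi_invertible_unit\<close>)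
  then show "xi_invertible i" by (simp add: xi_invertible_def hom_cat_iso_iff)
qed

lemma sub_eq_coact_fibre:
  assumes "xi_invertible j"
  shows "sub j = {i. xi_invertible i \<and> coact i = coact j}"
proof (rule Set.set_eqI, rule iffI)
  fix i assume "i \<in> sub j"
  then obtain u where u: "is_isomorphism (hom_cat B a a) u" "cod\<^sub>2 u = dom\<^sub>2 j" "i = j \<cdot> u"
    by (auto simp: subobject_def hom_cat_Hom_iff)
  then show "i \<in> {i. xi_invertible i \<and> coact i = coact j}"
    using A.coaction_precompose_iso[of f j u] assms coaction_eq
    by (simp add: f_Hom1 transpose_invertible_iff)
next
  fix i assume "i \<in> {i. xi_invertible i \<and> coact i = coact j}"
  then have i: "xi_invertible i" "coact i = coact j" by simp_all
  obtain u where "is_isomorphism (hom_cat B a a) u" "dom\<^sub>2 u = dom\<^sub>2 i" "cod\<^sub>2 u = dom\<^sub>2 j" "j \<cdot> u = i"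
    using A.coaction_eq_iso[of f i j] i assms by (auto simp: f_Hom1 transpose_invertible_iff coaction_eq)
  moreover have "is_mono (hom_cat B a a) i"
    by (rule A.transpose_invertible_mono[of f]) (simp_all add: f_Hom1 transpose_invertible_iff i)
  ultimately show "i \<in> sub j"
    using xi_invertible_simps[OF i(1)] xi_invertible_simps[OF assms]
    by (auto simp: subobject_def hom_cat_Hom_iff hom_cat_iso_iff hom_cat_Ar_iff)
qed

lemma sub_eq_iff_coact: "xi_invertible i \<Longrightarrow> xi_invertible j \<Longrightarrow> sub i = sub j \<longleftrightarrow> coact i = coact j"
  by (auto simp: sub_eq_coact_fibre)

abbreviation "InvSub \<equiv> Il B a (adj_monoid B f f' \<eta> \<epsilon>)"
abbreviation "EndComonoid \<equiv> comonoid_End B (adj_comonoid B f f' \<eta> \<epsilon>)"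

lemma invsub_carrier: "carrier InvSub = {sub i | i. xi_invertible i}"
  using left_invertible_iff by (simp add: Il_def adj_monoid_def)

lemma invsub_one: "one InvSub = sub \<eta>"
  by (simp add: Il_def adj_monoid_def)

lemma invsub_mult:
  assumes "xi_invertible i" "xi_invertible j"
  shows "sub i \<otimes>\<^bsub>InvSub\<^esub> sub j = sub (m \<cdot> (i \<diamondop> j))"
proof -
  have "sub (m \<cdot> (i' \<diamondop> j')) = sub (m \<cdot> (i \<diamondop> j))" if "i' \<in> sub i" "j' \<in> sub j" for i' j'
    using that assms by (simp add: sub_eq_coact_fibre sub_eq_iff_coact xi_invertible_product coact_product)
  moreover have "i \<in> sub i" "j \<in> sub j" using assms by (simp_all add: sub_eq_coact_fibre)
  ultimately have "(\<Union>i' \<in> sub i. \<Union>j' \<in> sub j. sub (m \<cdot> (i' \<diamondop> j'))) = sub (m \<cdot> (i \<diamondop> j))"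
    by blast
  then show ?thesis by (simp add: Il_def adj_monoid_def)
qed

text \<open>The choice of a representative is immaterial: \<open>coact\<close> is constant on a class by
  \<open>sub_eq_coact_fibre\<close>.\<close>

definition "\<Gamma> P = \<theta> (coact (SOME i. i \<in> P))"

lemma \<Gamma>_sub:
  assumes "xi_invertible i"
  shows "\<Gamma> (sub i) = \<theta> (coact i)"
proof -
  have "(SOME j. j \<in> sub i) \<in> sub i"
    by (rule someI[of _ i]) (simp add: sub_eq_coact_fibre assms)
  then show ?thesis by (simp add: \<Gamma>_def sub_eq_coact_fibre assms)
qed

lemma endo_\<theta>:
  assumes "xi_invertible i"
  shows "endo (\<theta> (coact i))"
  using f_coalgebra_coact[OF assms] assms by (simp add: endo_iff mate_\<theta>)

lemma \<Gamma>_bij: "bij_betw \<Gamma> (carrier InvSub) (carrier EndComonoid)"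
proof (rule bij_betwI')
  fix P Q assume "P \<in> carrier InvSub" "Q \<in> carrier InvSub"
  then obtain i j where ij: "xi_invertible i" "P = sub i" "xi_invertible j" "Q = sub j" by (auto simp: invsub_carrier)
  have "coact i = coact j" if "\<theta> (coact i) = \<theta> (coact j)"
    using arg_cong[OF that, of "\<lambda>\<phi>. \<a> f f' f \<cdot> mate \<phi>"] ij by (simp add: mate_\<theta>)
  then show "\<Gamma> P = \<Gamma> Q \<longleftrightarrow> P = Q" using ij by (auto simp: \<Gamma>_sub sub_eq_iff_coact)
next
  fix P assume "P \<in> carrier InvSub"
  then show "endo (\<Gamma> P)" by (auto simp: invsub_carrier \<Gamma>_sub endo_\<theta>)
next
  fix \<phi> assume "endo \<phi>"
  then have \<phi>: "ar \<phi>" "dom\<^sub>2 \<phi> = K" "cod\<^sub>2 \<phi> = K" "f_coalgebra (\<a> f f' f \<cdot> mate \<phi>)"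
    by (simp_all add: endo_iff)
  obtain i where i: "xi_invertible i" "coact i = \<a> f f' f \<cdot> mate \<phi>"
    using A.coalgebra_is_coaction[OF \<phi>(4)[unfolded f_coalgebra_def]] by (auto simp: transpose_invertible_iff coaction_eq)
  then have "\<phi> = \<Gamma> (sub i)" using \<phi> by (simp add: \<Gamma>_sub \<theta>_mate)
  then show "\<exists>P \<in> carrier InvSub. \<phi> = \<Gamma> P" using i by (auto simp: invsub_carrier)
qed

lemma \<Gamma>_mult:
  assumes "P \<in> carrier InvSub" "Q \<in> carrier InvSub"
  shows "P \<otimes>\<^bsub>InvSub\<^esub> Q \<in> carrier InvSub" "\<Gamma> (P \<otimes>\<^bsub>InvSub\<^esub> Q) = \<Gamma> P \<otimes>\<^bsub>EndComonoid\<^esub> \<Gamma> Q"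
proof -
  obtain i j where ij: "xi_invertible i" "P = sub i" "xi_invertible j" "Q = sub j" using assms by (auto simp: invsub_carrier)
  show "P \<otimes>\<^bsub>InvSub\<^esub> Q \<in> carrier InvSub" using ij by (auto simp: invsub_mult invsub_carrier xi_invertible_product)
  show "\<Gamma> (P \<otimes>\<^bsub>InvSub\<^esub> Q) = \<Gamma> P \<otimes>\<^bsub>EndComonoid\<^esub> \<Gamma> Q"
    using ij by (simp add: invsub_mult \<Gamma>_sub xi_invertible_product \<theta>_product) (simp add: comonoid_End_def adj_comonoid_def)
qed

lemma \<Gamma>_one: "one InvSub \<in> carrier InvSub" "\<Gamma> (one InvSub) = one EndComonoid"
  using xi_invertible_unit by (auto simp: invsub_one invsub_carrier \<Gamma>_sub \<theta>_unit comonoid_End_def adj_comonoid_def)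

lemma monoid_EndComonoid: "monoid EndComonoid"
proof
  note [simp] = comonoid_End_def adj_comonoid_def V.Hom_iff
  fix x y assume "x \<in> carrier EndComonoid" "y \<in> carrier EndComonoid"
  then have xy: "ar x" "dom\<^sub>2 x = K" "cod\<^sub>2 x = K" "ar y" "dom\<^sub>2 y = K" "cod\<^sub>2 y = K"
    "\<epsilon> \<cdot> x = \<epsilon>" "\<epsilon> \<cdot> y = \<epsilon>" "\<delta> \<cdot> x = (x \<diamondop> x) \<cdot> \<delta>" "\<delta> \<cdot> y = (y \<diamondop> y) \<cdot> \<delta>"
    by simp_all
  note [simp] = xy(1-6)
  have "\<epsilon> \<cdot> x \<cdot> y = \<epsilon>" by (simp add: V.Cmp_extend[OF xy(7)] xy(8))
  moreover have "\<delta> \<cdot> x \<cdot> y = ((x \<cdot> y) \<diamondop> (x \<cdot> y)) \<cdot> \<delta>"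
    by (simp add: V.Cmp_extend2[OF xy(9)] xy(10) interchange_eq[symmetric] V.assoc)
  ultimately show "x \<otimes>\<^bsub>EndComonoid\<^esub> y \<in> carrier EndComonoid" by simp
qed (auto simp: comonoid_End_def adj_comonoid_def V.Hom_iff V.assoc)

end

lemma monoid_transport:
  assumes "monoid H" and bij: "bij_betw h (carrier G) (carrier H)"
    and mult: "\<And>x y. x \<in> carrier G \<Longrightarrow> y \<in> carrier G \<Longrightarrow> x \<otimes>\<^bsub>G\<^esub> y \<in> carrier G"
      "\<And>x y. x \<in> carrier G \<Longrightarrow> y \<in> carrier G \<Longrightarrow> h (x \<otimes>\<^bsub>G\<^esub> y) = h x \<otimes>\<^bsub>H\<^esub> h y"
    and one: "one G \<in> carrier G" "h (one G) = one H"
  shows "monoid G"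
proof -
  interpret H: monoid H by fact
  have inj: "x = y" if "x \<in> carrier G" "y \<in> carrier G" "h x = h y" for x y
    using that bij by (auto simp: bij_betw_def dest: inj_onD)
  have h: "h x \<in> carrier H" if "x \<in> carrier G" for x
    using that bij by (auto simp: bij_betw_def)
  show ?thesis
    by standard (auto intro!: inj simp: mult one h H.m_assoc)
qed

theorem theorem2p17:
  fixes B :: "('o, 'a, 'c) bicat"
    and a b :: 'o and f f' :: 'a and \<eta> \<epsilon> :: 'c
  defines "S \<equiv> adj_monoid B f f' \<eta> \<epsilon>"
    and "K \<equiv> adj_comonoid B f f' \<eta> \<epsilon>"
  assumes "bicategory B"
    and "adjunction_in B a b f f' \<eta> \<epsilon>"
    and "comonadic (hom_cat B a a) (hom_cat B a b) (post_func B f) (post_func B f')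
           (post_unit B f f' \<eta>) (post_counit B f f' \<epsilon>)"
  shows "monoid (Il B a S) \<and> monoid (comonoid_End B K) \<and>
    (\<exists>\<Gamma> \<in> iso (Il B a S) (comonoid_End B K).
       \<Gamma> (one (Il B a S)) = one (comonoid_End B K) \<and>
       (\<forall>i. left_invertible B a S i \<longrightarrow>
          is_isomorphism (Vert B) (adj_xi B f f' \<epsilon> i) \<and>
          \<Gamma> (subobject (hom_cat B a a) i) = adj_theta B f f' \<epsilon> i))"
proof -
  interpret comonadic_internal_adjunction B a b f f' \<eta> \<epsilon>
    by (intro comonadic_internal_adjunction.intro internal_adjunction.intro
        internal_adjunction_axioms.intro comonadic_internal_adjunction_axioms.intro assms)
  have "monoid InvSub"
    by (rule monoid_transport[OF monoid_EndComonoid \<Gamma>_bij]) (simp_all add: \<Gamma>_mult \<Gamma>_one)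
  moreover have "\<Gamma> \<in> Group.iso InvSub EndComonoid"
    using \<Gamma>_bij by (auto simp: Group.iso_def hom_def \<Gamma>_mult bij_betw_apply)
  moreover have "iso\<^sub>2 (adj_xi B f f' \<epsilon> i)" "\<Gamma> (sub i) = adj_theta B f f' \<epsilon> i"
    if "left_invertible B a (adj_monoid B f f' \<eta> \<epsilon>) i" for i
    using that by (simp_all add: left_invertible_iff adj_xi_eq xi_invertible_simps \<Gamma>_sub adj_theta_eq)
  ultimately show ?thesis
    unfolding S_def K_def using monoid_EndComonoid \<Gamma>_one by blast
qed

end
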